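(* Let $(B_\gamma(t))_{t\in[0,T]}$, $\gamma\in\Gamma=\{0,\dots,P_\eta-1\}$, be the branches of a Brownian decision tree on $[0,T]$ with branching points $0<\tau_1<\dots<\tau_\eta<T$ and offspring numbers $N_1,\dots,N_\eta\ge 1$, where $P_\eta=\prod_{j=1}^\eta N_j$, and let $B$ be a standard one-dimensional Brownian motion. Then for every $c\in\mathbb{R}$, as $u\to\infty$, $$\mathbb{P}\{\exists\, t\in[0,T],\ \exists\,\gamma\in\Gamma:\ B_\gamma(t)-ct>u\}\sim P_\eta\,\mathbb{P}\{\exists\, t\in[0,T]:\ B(t)-ct>u\}\sim P_\eta\sqrt{\frac{2}{\pi}}\,\frac{\sqrt{T}}{u+cT}\exp\left(-\frac{(u+cT)^2}{2T}\right).$$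
   Context: Brownian decision tree. Fix $T>0$, an integer $\eta\ge 1$, deterministic branching points $0<\tau_1<\dots<\tau_\eta<T$ and integers $N_1,\dots,N_\eta\ge 1$. Conventions: $\tau_0=0$, $\tau_{\eta+1}=T$, $P_0=1$. Put $P_i=\prod_{j=1}^iN_j$, $\Gamma=\{0,1,\dots,P_\eta-1\}$, and let $i(t)=\max\{i\in\{1,\dots,\eta\}: t>\tau_i\}$ for $t>\tau_1$, $i(t)=0$ for $t\in[0,\tau_1]$. Let $B_0^*$ be a standard one-dimensional Brownian motion and, for $i=1,\dots,\eta$, let $\boldsymbol{B}_i^*$ be a standard $\mathbb{R}^{P_i}$-valued Brownian motion (independent components), all of these being mutually independent. Define $\widetilde{\boldsymbol{B}}_\Gamma(t)=B_0^*(t)$ for $t\in[0,\tau_1]$ and, recursively for $t\in(\tau_i,\tau_{i+1}]$, let $\widetilde{\boldsymbol{B}}_\Gamma(t)\in\mathbb{R}^{P_i}$ be the vector obtained by stacking $N_i$ copies of $\widetilde{\boldsymbol{B}}_\Gamma(\tau_i)\in\mathbb{R}^{P_{i-1}}$, plus $\boldsymbol{B}_i^*(t-\tau_i)$. The branch indexed by $\gamma\in\Gamma$ is $B_\gamma(t)=(\widetilde{\boldsymbol{B}}_\Gamma(t))_{(\gamma \bmod P_{i(t)})+1}$. The notation $f(u)\sim g(u)$ means $f(u)/g(u)\to1$. *)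

theory Defs
  imports "HOL-Probability.Probability" "HOL-Library.Landau_Symbols"
begin

text \<open>
  Processes have time set \<open>[0, \<infinity>)\<close>; values at negative times are irrelevant. As is usual, paths start
  at 0 and are continuous only almost surely. Events that quantify over uncountably many times are
  therefore measurable only up to a null set, and their probabilities are taken in the completion
  of the underlying probability space.
\<close>

locale std_brownian_motion = prob_space M
  for M :: "'a measure" and W :: "real \<Rightarrow> 'a \<Rightarrow> real" +
  assumes measurable_W: "\<And>t. 0 \<le> t \<Longrightarrow> W t \<in> borel_measurable M"
    and start_zero: "AE \<omega> in M. W 0 \<omega> = 0"
    and indep_increments:
      "\<And>(n::nat) (t :: nat \<Rightarrow> real). 0 \<le> t 0 \<Longrightarrow> (\<And>k. k < n \<Longrightarrow> t k < t (Suc k)) \<Longrightarrow>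
         indep_vars (\<lambda>_. borel) (\<lambda>k \<omega>. W (t (Suc k)) \<omega> - W (t k) \<omega>) {..<n}"
    and normal_increments:
      "\<And>s t. 0 \<le> s \<Longrightarrow> s < t \<Longrightarrow>
         distributed M lborel (\<lambda>\<omega>. W t \<omega> - W s \<omega>) (normal_density 0 (sqrt (t - s)))"
    and continuous_paths: "AE \<omega> in M. continuous_on {0..} (\<lambda>t. W t \<omega>)"

text \<open>
  An \<open>\<real>\<^sup>n\<close>-valued process is a family of coordinate processes indexed by \<open>j < n\<close>. Independence of
  processes is independence of their paths, as random elements of the product space
  over \<open>[0, \<infinity>)\<close>, jointly over all coordinates in the vector-valued case.
\<close>

locale std_vector_brownian_motion = prob_space M
  for M :: "'a measure" and n :: nat and W :: "nat \<Rightarrow> real \<Rightarrow> 'a \<Rightarrow> real" +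
  assumes coordinates: "\<And>j. j < n \<Longrightarrow> std_brownian_motion M (W j)"
    and indep_coordinates:
      "indep_vars (\<lambda>_. \<Pi>\<^sub>M t\<in>{0..}. borel) (\<lambda>j \<omega>. \<lambda>t\<in>{0..}. W j t \<omega>) {..<n}"

definition offspring_prod :: "(nat \<Rightarrow> nat) \<Rightarrow> nat \<Rightarrow> nat" where
  "offspring_prod N i = (\<Prod>j = 1..i. N j)"

text \<open>
  The driving motions of the tree: \<open>X i j\<close> is coordinate \<open>j\<close> of the motion used after the \<open>i\<close>-th
  branching point; \<open>X 0 0\<close> is the one-dimensional motion used before the first one.
\<close>

locale tree_driving_motions = prob_space M
  for M :: "'a measure" and \<eta> :: nat and N :: "nat \<Rightarrow> nat"
    and X :: "nat \<Rightarrow> nat \<Rightarrow> real \<Rightarrow> 'a \<Rightarrow> real" +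
  assumes vector_motions:
      "\<And>i. i \<le> \<eta> \<Longrightarrow> std_vector_brownian_motion M (offspring_prod N i) (X i)"
    and indep_motions:
      "indep_vars (\<lambda>i. \<Pi>\<^sub>M p\<in>{..<offspring_prod N i} \<times> {0..}. borel)
         (\<lambda>i \<omega>. \<lambda>(j, t)\<in>{..<offspring_prod N i} \<times> {0..}. X i j t \<omega>) {..\<eta>}"

definition tree_level :: "nat \<Rightarrow> (nat \<Rightarrow> real) \<Rightarrow> real \<Rightarrow> nat" where
  "tree_level \<eta> \<tau> t = (if t > \<tau> 1 then Max {i \<in> {1..\<eta>}. t > \<tau> i} else 0)"

text \<open>
  \<open>level_vector \<tau> N X i t \<omega>\<close> is the formula for the stacked vector on the \<open>i\<close>-th time interval
  \<open>(\<tau> i, \<tau> (i + 1)]\<close>, with coordinates numbered from 0. Coordinate \<open>j\<close> of copies of a vector of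
  length \<open>n\<close> stacked on top of each other is coordinate \<open>j mod n\<close> of that vector.
\<close>

primrec level_vector ::
  "(nat \<Rightarrow> real) \<Rightarrow> (nat \<Rightarrow> nat) \<Rightarrow> (nat \<Rightarrow> nat \<Rightarrow> real \<Rightarrow> 'a \<Rightarrow> real) \<Rightarrow> nat \<Rightarrow> real \<Rightarrow> 'a \<Rightarrow> nat \<Rightarrow> real"
where
  "level_vector \<tau> N X 0 t \<omega> = (\<lambda>j. X 0 j t \<omega>)"
| "level_vector \<tau> N X (Suc i) t \<omega> =
     (\<lambda>j. level_vector \<tau> N X i (\<tau> (Suc i)) \<omega> (j mod offspring_prod N i)
        + X (Suc i) j (t - \<tau> (Suc i)) \<omega>)"

definition branch ::
  "nat \<Rightarrow> (nat \<Rightarrow> real) \<Rightarrow> (nat \<Rightarrow> nat) \<Rightarrow> (nat \<Rightarrow> nat \<Rightarrow> real \<Rightarrow> 'a \<Rightarrow> real) \<Rightarrow> nat \<Rightarrow> real \<Rightarrow> 'a \<Rightarrow> real"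
where
  "branch \<eta> \<tau> N X \<gamma> t \<omega> =
     (let i = tree_level \<eta> \<tau> t in level_vector \<tau> N X i t \<omega> (\<gamma> mod offspring_prod N i))"

end

theory Submission
  imports Defs "HOL-Real_Asymp.Real_Asymp"
begin

text \<open>
  Both probabilities are compared with one explicit function. Let \<open>\<Psi>\<close> be the upper tail of the
  standard normal law and \<open>g u = \<Psi> ((u + c T) / \<surd>T)\<close> the probability that a single motion with drift
  is above \<open>u\<close> at the final time. The reason for the factor 2 in the formula is that a path which
  reaches a high level \<open>u\<close> at all most likely does so just before \<open>T\<close>. From there on it moves by an almost
  symmetric Gaussian amount, the drift over the remaining short time being negligible. About half of the
  paths that reach \<open>u\<close> thus end above \<open>u\<close>, so the hitting probability is asymptotic to \<open>2 g u\<close>,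
  and Mills' ratio turns \<open>2 g u\<close> into the explicit expression. The reason for the factor \<open>P\<^sub>\<eta>\<close> is that
  two different branches have independent increments after the last branching point \<open>\<tau>\<^sub>\<eta> < T\<close>. The
  sum of their end points has variance at most \<open>2 T + 2 \<tau>\<^sub>\<eta> < 4 T\<close>, so that both reach \<open>u\<close> with a
  probability of smaller exponential order than \<open>g u\<close>. By the Bonferroni inequalities, the
  probability of the union is then asymptotic to the sum of the probabilities of the branches.

  All estimates are made for Gaussian random walks on a finite time grid. Splitting at the first
  passage \<open>k\<close> gives an event that depends on the steps before \<open>k\<close> only, hence is
  independent of the remaining increment. If the remaining increment is favourable with probability
  at least \<open>\<alpha>\<close> for every \<open>k\<close>, then \<open>\<alpha>\<close> times the hitting probability is at most the probability to
  end above \<open>u\<close> (\<open>passage_imp_end\<close>). With \<open>\<alpha>\<close> close to \<open>1/2\<close> for passages in a short final window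
  this is the upper bound \<open>walk_hit_upper\<close>. Applied first to one walk and then to another, the same
  inequality bounds the probability that both reach the level (\<open>pair_hit_le\<close>). For the lower bound
  \<open>walk_hit_lower\<close> the increments after the first passage are compared with their reflections. On a
  grid the walk may jump past the level, but the overshoot vanishes as the mesh goes to 0.

  The tree is cut into steps by dividing every interval between branching points equally. All steps
  of all driving motions form one independent family of normal variables, and each branch adds up
  the steps that it runs through (\<open>walk_grid_tree\<close>). Path continuity carries the bounds for walks
  over to the processes (\<open>hit_prob_bounds\<close>), uniformly in the mesh, and
  \<open>hit_prob_asymptotics\<close> lets \<open>u\<close> tend to infinity. A single Brownian motion is the case of one walk.
\<close>

section \<open>The upper tail of the standard normal law\<close>

definition gaussian_tail :: "real \<Rightarrow> real" where
  "gaussian_tail x = measure (density lborel std_normal_density) {x<..}"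

lemma prob_space_std_normal: "prob_space (density lborel (\<lambda>x. ennreal (std_normal_density x)))"
  using prob_space_normal_density[of 1 0] by simp

lemma emeasure_std_normal:
  assumes "A \<in> sets borel"
  shows "emeasure (density lborel std_normal_density) A
    = (\<integral>\<^sup>+x. ennreal (std_normal_density x) * indicator A x \<partial>lborel)"
  using assms by (intro emeasure_density) auto

lemma gaussian_tail_nn_integral:
  "ennreal (gaussian_tail x) = (\<integral>\<^sup>+y. ennreal (std_normal_density y) * indicator {x..} y \<partial>lborel)"
proof -
  interpret prob_space "density lborel std_normal_density" by (rule prob_space_std_normal)
  have "ennreal (gaussian_tail x) = emeasure (density lborel std_normal_density) {x<..}"
    by (simp add: gaussian_tail_def emeasure_eq_measure)
  also have "\<dots> = (\<integral>\<^sup>+y. ennreal (std_normal_density y) * indicator {x<..} y \<partial>lborel)"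
    by (rule emeasure_std_normal) simp
  also have "\<dots> = (\<integral>\<^sup>+y. ennreal (std_normal_density y) * indicator {x..} y \<partial>lborel)"
    using AE_lborel_singleton[of x]
    by (intro nn_integral_cong_AE) (auto elim!: eventually_mono split: split_indicator)
  finally show ?thesis .
qed

lemma gaussian_tail_antimono: "x \<le> y \<Longrightarrow> gaussian_tail y \<le> gaussian_tail x"
proof -
  interpret prob_space "density lborel std_normal_density" by (rule prob_space_std_normal)
  show "x \<le> y \<Longrightarrow> gaussian_tail y \<le> gaussian_tail x"
    unfolding gaussian_tail_def by (intro finite_measure_mono) auto
qed

lemma gaussian_tail_nonneg [simp]: "0 \<le> gaussian_tail x"
  by (simp add: gaussian_tail_def)

text \<open>
  The standard normal density is at most 1. This replaces all finer estimates of how drift and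
  overshoot change Gaussian probabilities.
\<close>

lemma gaussian_tail_lipschitz:
  assumes "x \<le> y"
  shows "gaussian_tail x - gaussian_tail y \<le> y - x"
proof -
  interpret prob_space "density lborel std_normal_density" by (rule prob_space_std_normal)
  have "std_normal_density z \<le> 1" for z
  proof -
    have "1 / sqrt (2 * pi) \<le> 1" using pi_gt3 by simp
    moreover have "exp (- z\<^sup>2 / 2) \<le> 1" by simp
    ultimately have "1 / sqrt (2 * pi) * exp (- z\<^sup>2 / 2) \<le> 1 * 1"
      by (intro mult_mono) auto
    then show ?thesis by (simp add: std_normal_density_def)
  qed
  note le1 = this
  have "{x<..} = {x<..y} \<union> {y<..}" using assms by auto
  moreover have "prob ({x<..y} \<union> {y<..}) = prob {x<..y} + prob {y<..}"
    by (rule finite_measure_Union) auto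
  ultimately have "gaussian_tail x = measure (density lborel std_normal_density) {x<..y} + gaussian_tail y"
    unfolding gaussian_tail_def by (simp only:)
  moreover have "emeasure (density lborel std_normal_density) {x<..y} \<le> ennreal (y - x)"
  proof -
    have "emeasure (density lborel std_normal_density) {x<..y}
        = (\<integral>\<^sup>+z. ennreal (std_normal_density z) * indicator {x<..y} z \<partial>lborel)"
      by (rule emeasure_std_normal) simp
    also have "\<dots> \<le> (\<integral>\<^sup>+z. indicator {x<..y} z \<partial>lborel)"
      using le1 by (intro nn_integral_mono) (auto split: split_indicator)
    also have "\<dots> = ennreal (y - x)" using assms by simp
    finally show ?thesis .
  qed
  ultimately show ?thesis using assms by (simp add: emeasure_eq_measure)
qed

context prob_space
begin

lemma normal_upper_tail:
  assumes "distributed M lborel X (normal_density 0 \<sigma>)" "\<sigma> > 0"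
  shows "prob {\<omega> \<in> space M. X \<omega> > x} = gaussian_tail (x / \<sigma>)"
proof -
  have std: "distributed M lborel (\<lambda>\<omega>. X \<omega> / \<sigma>) std_normal_density"
    using assms normal_standard_normal_convert[of \<sigma> X 0] by simp
  then have rv: "(\<lambda>\<omega>. X \<omega> / \<sigma>) \<in> measurable M lborel"
    and d: "distr M lborel (\<lambda>\<omega>. X \<omega> / \<sigma>) = density lborel std_normal_density"
    by (auto simp: distributed_def)
  have "gaussian_tail (x / \<sigma>) = measure (distr M lborel (\<lambda>\<omega>. X \<omega> / \<sigma>)) {x / \<sigma><..}"
    by (simp add: d gaussian_tail_def)
  also have "\<dots> = prob ((\<lambda>\<omega>. X \<omega> / \<sigma>) -` {x / \<sigma><..} \<inter> space M)"
    using rv by (intro measure_distr) auto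
  also have "(\<lambda>\<omega>. X \<omega> / \<sigma>) -` {x / \<sigma><..} \<inter> space M = {\<omega> \<in> space M. X \<omega> > x}"
    using assms(2) by (auto simp: divide_simps)
  finally show ?thesis by simp
qed

lemma normal_point:
  assumes "distributed M lborel X (normal_density 0 \<sigma>)"
  shows "prob {\<omega> \<in> space M. X \<omega> = x} = 0"
proof -
  have rv: "X \<in> measurable M lborel" and d: "distr M lborel X = density lborel (normal_density 0 \<sigma>)"
    using assms by (auto simp: distributed_def)
  have "emeasure M {\<omega> \<in> space M. X \<omega> = x} = emeasure (distr M lborel X) {x}"
    using rv by (subst emeasure_distr) (auto intro!: arg_cong[where f="emeasure M"])
  also have "\<dots> = (\<integral>\<^sup>+y. ennreal (normal_density 0 \<sigma> y) * indicator {x} y \<partial>lborel)"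
    by (simp add: d emeasure_density)
  also have "\<dots> = 0"
    using AE_lborel_singleton[of x]
    by (subst nn_integral_0_iff_AE) (simp, elim eventually_mono, auto split: split_indicator)
  finally show ?thesis by (simp add: measure_def)
qed

lemma normal_upper_tail_closed:
  assumes "distributed M lborel X (normal_density 0 \<sigma>)" "\<sigma> > 0"
  shows "prob {\<omega> \<in> space M. X \<omega> \<ge> x} = gaussian_tail (x / \<sigma>)"
proof -
  have [measurable]: "X \<in> borel_measurable M" using assms by (auto simp: distributed_def)
  have "{\<omega> \<in> space M. X \<omega> \<ge> x} = {\<omega> \<in> space M. X \<omega> > x} \<union> {\<omega> \<in> space M. X \<omega> = x}" by auto
  then have "prob {\<omega> \<in> space M. X \<omega> \<ge> x} = prob {\<omega> \<in> space M. X \<omega> > x} + prob {\<omega> \<in> space M. X \<omega> = x}"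
    by (simp only:) (rule finite_measure_Union, auto)
  then show ?thesis using normal_point[OF assms(1)] normal_upper_tail[OF assms] by simp
qed

lemma normal_lower_tail_closed:
  assumes "distributed M lborel X (normal_density 0 \<sigma>)" "\<sigma> > 0"
  shows "prob {\<omega> \<in> space M. X \<omega> \<le> - x} = gaussian_tail (x / \<sigma>)"
proof -
  have "distributed M lborel (\<lambda>\<omega>. - X \<omega>) (normal_density 0 \<sigma>)"
    using normal_density_affine[OF assms, of "-1" 0] by simp
  moreover have "(X \<omega> \<le> - x) = (- X \<omega> \<ge> x)" for \<omega> by linarith
  ultimately show ?thesis using normal_upper_tail_closed[of "\<lambda>\<omega>. - X \<omega>" \<sigma> x] assms(2) by simp
qed

end

lemma gaussian_tail_0: "gaussian_tail 0 = 1 / 2"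
proof -
  interpret prob_space "density lborel std_normal_density" by (rule prob_space_std_normal)
  have d: "distributed (density lborel std_normal_density) lborel (\<lambda>x. x) (normal_density 0 1)"
    by (auto simp: distributed_def distr_id2)
  have "1 = prob {x. True}" using prob_space by simp
  also have "{x::real. True} = {x. x \<le> - 0} \<union> {x. x > 0}" by auto
  also have "prob \<dots> = prob {x. x \<le> - 0} + prob {x. x > 0}"
    by (rule finite_measure_Union) auto
  also have "\<dots> = 2 * gaussian_tail 0"
    using normal_lower_tail_closed[OF d, of 0] normal_upper_tail[OF d, of 0] by simp
  finally show ?thesis by simp
qed

lemma std_normal_density_tendsto_0: "((\<lambda>y. - (std_normal_density y / y)) \<longlongrightarrow> 0) at_top"
proof -
  have "((\<lambda>y. - (1 / sqrt (2 * pi)) * (exp (- y\<^sup>2 / 2) / y)) \<longlongrightarrow> - (1 / sqrt (2 * pi)) * 0) at_top"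
  proof (intro tendsto_mult tendsto_const)
    have "((\<lambda>y::real. 1 / y) \<longlongrightarrow> 0) at_top" by (rule tendsto_divide_0[OF tendsto_const]) (simp add: filterlim_at_top_imp_at_infinity filterlim_ident)
    then show "((\<lambda>y::real. exp (- y\<^sup>2 / 2) / y) \<longlongrightarrow> 0) at_top"
      by (rule tendsto_0_le[where K=1]) (auto intro!: eventually_at_top_linorderI[of 1] simp: divide_simps)
  qed
  then show ?thesis by (simp add: std_normal_density_def)
qed

text \<open>
  The integrand is the derivative of \<open>y \<mapsto> - \<phi> y / y\<close>, where \<open>\<phi>\<close> is the density. As the factor
  \<open>1 + 1 / y\<^sup>2\<close> lies between 1 and its value at \<open>x\<close>, this one integral yields both the upper and the
  lower bound of Mills' ratio.
\<close>

lemma mills_identity: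
  assumes "x > 0"
  shows "(\<integral>\<^sup>+y. ennreal (std_normal_density y * (1 + 1 / y\<^sup>2)) * indicator {x..} y \<partial>lborel)
    = ennreal (std_normal_density x / x)"
proof -
  have "((\<lambda>y. - (std_normal_density y / y)) has_real_derivative std_normal_density y * (1 + 1 / y\<^sup>2)) (at y)"
    if "x \<le> y" for y
  proof -
    have "y > 0" using that assms by simp
    then show ?thesis
      unfolding std_normal_density_def
      by (auto intro!: derivative_eq_intros simp: divide_simps power2_eq_square) (simp add: algebra_simps)
  qed
  then show ?thesis
    by (subst nn_integral_FTC_atLeast[where F="\<lambda>y. - (std_normal_density y / y)" and T=0])
       (use std_normal_density_tendsto_0 in auto)
qed

lemma mills_upper:
  assumes "x > 0"
  shows "gaussian_tail x \<le> std_normal_density x / x"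
proof -
  have "ennreal (gaussian_tail x) \<le> ennreal (std_normal_density x / x)"
    unfolding gaussian_tail_nn_integral mills_identity[OF assms, symmetric]
    by (intro nn_integral_mono) (auto split: split_indicator simp: algebra_simps intro!: ennreal_leI)
  then show ?thesis using assms by (simp add: std_normal_density_def)
qed

lemma mills_lower:
  assumes "x > 0"
  shows "std_normal_density x / x \<le> (1 + 1 / x\<^sup>2) * gaussian_tail x"
proof -
  have "ennreal (std_normal_density x / x)
      \<le> (\<integral>\<^sup>+y. ennreal (1 + 1 / x\<^sup>2) * (ennreal (std_normal_density y) * indicator {x..} y) \<partial>lborel)"
    unfolding mills_identity[OF assms, symmetric]
  proof (intro nn_integral_mono)
    fix y
    have "std_normal_density y * (1 + 1 / y\<^sup>2) \<le> (1 + 1 / x\<^sup>2) * std_normal_density y" if "x \<le> y"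
    proof -
      have "1 / y\<^sup>2 \<le> 1 / x\<^sup>2" using that assms by (intro divide_left_mono) (auto intro!: power_mono)
      then show ?thesis by (subst mult.commute, intro mult_right_mono) auto
    qed
    then show "ennreal (std_normal_density y * (1 + 1 / y\<^sup>2)) * indicator {x..} y
      \<le> ennreal (1 + 1 / x\<^sup>2) * (ennreal (std_normal_density y) * indicator {x..} y)"
      by (auto split: split_indicator simp: ennreal_mult[symmetric] simp del: ennreal_plus intro!: ennreal_leI)
  qed
  also have "\<dots> = ennreal ((1 + 1 / x\<^sup>2) * gaussian_tail x)"
    by (subst nn_integral_cmult) (auto simp: gaussian_tail_nn_integral[symmetric] ennreal_mult)
  finally show ?thesis by simp
qed

lemma gaussian_tail_pos: "0 < gaussian_tail x"
proof -
  let ?y = "max x 1"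
  have "0 < std_normal_density ?y / ?y" by (simp add: normal_density_pos)
  also have "\<dots> \<le> (1 + 1 / ?y\<^sup>2) * gaussian_tail ?y" by (rule mills_lower) simp
  finally have "gaussian_tail ?y \<noteq> 0" by auto
  then have "0 < gaussian_tail ?y" using gaussian_tail_nonneg[of ?y] by linarith
  also have "\<dots> \<le> gaussian_tail x" by (rule gaussian_tail_antimono) simp
  finally show ?thesis .
qed

text \<open>
  A crude bound, for the probability of large single steps: a step of variance \<open>\<Delta>\<close> exceeds a fixed
  \<open>\<epsilon>\<close> with probability \<open>O(\<Delta>\<^sup>2)\<close>, so that the sum over all steps of a grid is of the order of the mesh.
\<close>

lemma gaussian_tail_power4:
  assumes "x \<ge> 1"
  shows "gaussian_tail x \<le> 8 / x ^ 4"
proof -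
  have "1 + x\<^sup>2 / 2 + (x\<^sup>2 / 2)\<^sup>2 / 2 \<le> exp (x\<^sup>2 / 2)"
    by (rule exp_lower_Taylor_quadratic) simp
  then have e: "x ^ 4 / 8 \<le> exp (x\<^sup>2 / 2)"
    by (simp add: power_mult_distrib power_divide flip: power_mult) (use zero_le_power2[of x] in linarith)
  have "gaussian_tail x \<le> std_normal_density x / x" using assms by (intro mills_upper) simp
  also have "\<dots> \<le> exp (- x\<^sup>2 / 2)"
  proof -
    have "1 / sqrt (2 * pi) / x \<le> 1"
    proof -
      have "1 \<le> sqrt (2 * pi)" using pi_gt3 by simp
      then have "1 * 1 \<le> sqrt (2 * pi) * x" using assms by (intro mult_mono) auto
      then show ?thesis using assms by (simp add: divide_simps)
    qed
    then have "1 / sqrt (2 * pi) / x * exp (- x\<^sup>2 / 2) \<le> 1 * exp (- x\<^sup>2 / 2)"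
      by (intro mult_right_mono) auto
    then show ?thesis by (simp add: std_normal_density_def)
  qed
  also have "\<dots> = 1 / exp (x\<^sup>2 / 2)" by (simp add: exp_minus field_simps)
  also have "\<dots> \<le> 1 / (x ^ 4 / 8)" using assms e by (intro divide_left_mono) auto
  finally show ?thesis by simp
qed

lemma gaussian_tail_mills: "gaussian_tail \<sim>[at_top] (\<lambda>x. std_normal_density x / x)"
proof (rule asymp_equivI', rule tendsto_sandwich)
  show "((\<lambda>x::real. 1 / (1 + 1 / x\<^sup>2)) \<longlongrightarrow> 1) at_top" by real_asymp
  show "\<forall>\<^sub>F x in at_top. 1 / (1 + 1 / x\<^sup>2) \<le> gaussian_tail x / (std_normal_density x / x)"
    using eventually_gt_at_top[of 0]
  proof eventually_elim
    case (elim x)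
    have p: "0 < std_normal_density x / x" using elim by (simp add: normal_density_pos)
    have q: "0 < 1 + 1 / x\<^sup>2" by (simp add: add_pos_nonneg)
    show ?case
      using mills_lower[OF elim] p q
      by (subst pos_divide_le_eq[OF q], subst times_divide_eq_left, subst pos_le_divide_eq[OF p]) (simp add: mult.commute)
  qed
  show "\<forall>\<^sub>F x in at_top. gaussian_tail x / (std_normal_density x / x) \<le> 1"
    using eventually_gt_at_top[of 0]
  proof eventually_elim
    case (elim x)
    then have p: "0 < std_normal_density x / x" by (simp add: normal_density_pos)
    show ?case using mills_upper[OF elim] by (subst pos_divide_le_eq[OF p]) simp
  qed
qed simp

lemma gaussian_tail_affine:
  assumes "0 < \<sigma>"
  shows "(\<lambda>u. gaussian_tail ((u + b) / \<sigma>)) \<sim>[at_top] (\<lambda>u. std_normal_density ((u + b) / \<sigma>) / ((u + b) / \<sigma>))"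
proof (rule asymp_equiv_compose'[OF gaussian_tail_mills])
  show "LIM u at_top. (u + b) / \<sigma> :> at_top" using assms by real_asymp
qed

text \<open>
  A smaller standard deviation is decisive, whatever the shifts \<open>a\<close> and \<open>b\<close>. All error terms below
  are tails of this kind.
\<close>

lemma gaussian_tail_ratio:
  assumes "0 < \<sigma>" "\<sigma> < \<rho>"
  shows "((\<lambda>u. gaussian_tail ((u + a) / \<sigma>) / gaussian_tail ((u + b) / \<rho>)) \<longlongrightarrow> 0) at_top"
proof -
  have \<rho>: "0 < \<rho>" using assms by simp
  define \<kappa> where "\<kappa> = (1 / \<sigma>\<^sup>2 - 1 / \<rho>\<^sup>2) / 2"
  have "\<sigma>\<^sup>2 < \<rho>\<^sup>2" using assms by (intro power_strict_mono) auto
  then have \<kappa>: "0 < \<kappa>" using assms by (simp add: \<kappa>_def frac_less2)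
  \<comment> \<open>The quotient of the two densities is \<open>exp (- \<kappa> u\<^sup>2 - q u - r)\<close>.\<close>
  define q where "q = a / \<sigma>\<^sup>2 - b / \<rho>\<^sup>2"
  define r where "r = (a\<^sup>2 / \<sigma>\<^sup>2 - b\<^sup>2 / \<rho>\<^sup>2) / 2"
  have "(\<lambda>u. gaussian_tail ((u + a) / \<sigma>) / gaussian_tail ((u + b) / \<rho>))
    \<sim>[at_top] (\<lambda>u. (std_normal_density ((u + a) / \<sigma>) / ((u + a) / \<sigma>))
      / (std_normal_density ((u + b) / \<rho>) / ((u + b) / \<rho>)))"
    using assms \<rho> by (intro asymp_equiv_divide gaussian_tail_affine)
  moreover have "((\<lambda>u. (std_normal_density ((u + a) / \<sigma>) / ((u + a) / \<sigma>))
      / (std_normal_density ((u + b) / \<rho>) / ((u + b) / \<rho>))) \<longlongrightarrow> 0) at_top"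
  proof -
    have "std_normal_density ((u + a) / \<sigma>) / std_normal_density ((u + b) / \<rho>)
        = exp (- \<kappa> * u\<^sup>2 - q * u - r)" for u
    proof -
      have "- ((u + a) / \<sigma>)\<^sup>2 / 2 + ((u + b) / \<rho>)\<^sup>2 / 2 = - \<kappa> * u\<^sup>2 - q * u - r"
        using assms \<rho> by (simp add: \<kappa>_def q_def r_def field_simps power2_eq_square)
      then show ?thesis
        by (simp add: std_normal_density_def exp_diff[symmetric])
    qed
    then have eq: "(std_normal_density ((u + a) / \<sigma>) / ((u + a) / \<sigma>))
      / (std_normal_density ((u + b) / \<rho>) / ((u + b) / \<rho>))
      = exp (- \<kappa> * u\<^sup>2 - q * u - r) * (((u + b) / \<rho>) / ((u + a) / \<sigma>))" for u
      by (metis (no_types, opaque_lifting) divide_divide_times_eq mult.commute times_divide_times_eq)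
    have "((\<lambda>u. exp (- \<kappa> * u\<^sup>2 - q * u - r) * (((u + b) / \<rho>) / ((u + a) / \<sigma>))) \<longlongrightarrow> 0) at_top"
      using \<kappa> \<rho> assms(1) by real_asymp
    then show ?thesis by (simp only: eq)
  qed
  ultimately show ?thesis using tendsto_asymp_equiv_cong by blast
qed

lemma gaussian_tail_explicit:
  assumes "0 < T"
  shows "(\<lambda>u. 2 * gaussian_tail ((u + b) / sqrt T))
    \<sim>[at_top] (\<lambda>u. sqrt (2 / pi) * (sqrt T / (u + b)) * exp (- ((u + b)\<^sup>2 / (2 * T))))"
proof -
  have "(\<lambda>u. 2 * gaussian_tail ((u + b) / sqrt T))
    \<sim>[at_top] (\<lambda>u. 2 * (std_normal_density ((u + b) / sqrt T) / ((u + b) / sqrt T)))"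
    using assms by (intro asymp_equiv_mult asymp_equiv_refl gaussian_tail_affine) auto
  also have "(\<lambda>u. 2 * (std_normal_density ((u + b) / sqrt T) / ((u + b) / sqrt T)))
    = (\<lambda>u. sqrt (2 / pi) * (sqrt T / (u + b)) * exp (- ((u + b)\<^sup>2 / (2 * T))))"
  proof
    fix u
    have "2 / sqrt (2 * pi) = sqrt (2 / pi)"
      by (simp add: real_sqrt_mult real_sqrt_divide field_simps)
    moreover have "((u + b) / sqrt T)\<^sup>2 / 2 = (u + b)\<^sup>2 / (2 * T)"
      using assms by (simp add: power_divide)
    then have "2 * (std_normal_density ((u + b) / sqrt T) / ((u + b) / sqrt T))
      = 2 / sqrt (2 * pi) * (sqrt T / (u + b)) * exp (- ((u + b)\<^sup>2 / (2 * T)))"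
      by (simp add: std_normal_density_def)
    ultimately show "2 * (std_normal_density ((u + b) / sqrt T) / ((u + b) / sqrt T))
      = sqrt (2 / pi) * (sqrt T / (u + b)) * exp (- ((u + b)\<^sup>2 / (2 * T)))"
      by (simp only:)
  qed
  finally show ?thesis .
qed

lemma isCont_gaussian_tail: "isCont gaussian_tail x"
proof -
  have "\<bar>gaussian_tail y - gaussian_tail x\<bar> \<le> \<bar>y - x\<bar>" for y
    using gaussian_tail_lipschitz[of x y] gaussian_tail_lipschitz[of y x]
      gaussian_tail_antimono[of x y] gaussian_tail_antimono[of y x] by linarith
  then have "\<exists>d>0. \<forall>y. dist y x < d \<longrightarrow> dist (gaussian_tail y) (gaussian_tail x) < e" if "e > 0" for e
    using that by (intro exI[of _ e]) (auto simp: dist_real_def intro: le_less_trans)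
  then show ?thesis by (simp add: continuous_at_eps_delta)
qed

section \<open>Independent families and a Bonferroni inequality\<close>

lemma (in prob_space) indep_vars_reindex:
  assumes "indep_vars M' X A" "inj_on f I" "f ` I \<subseteq> A"
  shows "indep_vars (\<lambda>i. M' (f i)) (\<lambda>i. X (f i)) I"
  unfolding indep_vars_def
proof (intro conjI ballI indep_setsI)
  let ?E = "\<lambda>i. sigma_sets (space M) {X i -` B \<inter> space M |B. B \<in> sets (M' i)}"
  have X: "\<forall>i\<in>A. random_variable (M' i) (X i)" and E: "indep_sets ?E A"
    using assms(1) by (auto simp: indep_vars_def)
  { fix i assume "i \<in> I"
    then show "random_variable (M' (f i)) (X (f i))" using X assms(3) by auto }
  { fix i assume "i \<in> I"
    then show "?E (f i) \<subseteq> events" using E assms(3) by (auto simp: indep_sets_def) }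
  fix B J assume J: "J \<noteq> {}" "J \<subseteq> I" "finite J" and B: "\<forall>j\<in>J. B j \<in> ?E (f j)"
  have inj: "inj_on f J" using assms(2) J(2) by (rule inj_on_subset)
  let ?B = "\<lambda>j. B (the_inv_into J f j)"
  have "prob (\<Inter>j\<in>f ` J. ?B j) = (\<Prod>j\<in>f ` J. prob (?B j))"
    using J B assms(3) inj by (intro indep_setsD[OF E]) (auto simp: the_inv_into_f_f)
  then show "prob (\<Inter>j\<in>J. B j) = (\<Prod>j\<in>J. prob (B j))"
    using inj by (simp add: prod.reindex the_inv_into_f_f cong: INF_cong)
qed

lemma (in prob_space) indep_vars_disjoint_blocks:
  assumes "indep_vars N X A" "A1 \<subseteq> A" "A2 \<subseteq> A" "A1 \<inter> A2 = {}"
    and [measurable]: "Measurable.pred (PiM A1 N) p" "Measurable.pred (PiM A2 N) q"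
  shows "prob {\<omega> \<in> space M. p (\<lambda>i\<in>A1. X i \<omega>) \<and> q (\<lambda>i\<in>A2. X i \<omega>)}
    = prob {\<omega> \<in> space M. p (\<lambda>i\<in>A1. X i \<omega>)} * prob {\<omega> \<in> space M. q (\<lambda>i\<in>A2. X i \<omega>)}"
proof -
  let ?X = "\<lambda>\<omega>. \<lambda>i\<in>A1. X i \<omega>" and ?Y = "\<lambda>\<omega>. \<lambda>i\<in>A2. X i \<omega>"
  let ?P = "{x \<in> space (PiM A1 N). p x}" and ?Q = "{x \<in> space (PiM A2 N). q x}"
  have ind: "indep_var (PiM A1 N) ?X (PiM A2 N) ?Y"
    by (rule indep_var_restrict[OF assms(1,4,2,3)])
  then have rv: "?X \<in> measurable M (PiM A1 N)" "?Y \<in> measurable M (PiM A2 N)"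
    by (auto simp: indep_var_eq)
  have "?P \<in> sets (PiM A1 N)" "?Q \<in> sets (PiM A2 N)" by measurable
  from indep_varD[OF ind this] show ?thesis
    using measurable_space[OF rv(1)] measurable_space[OF rv(2)]
    by (simp add: vimage_def Int_def conj_ac cong: conj_cong)
qed

text \<open>
  Independence of independent groups: a family that is independent inside every group is independent
  as a whole if each of its members is a function of the random element \<open>Y i\<close> of its group and the
  \<open>Y i\<close> are independent. On a rectangle of events, the product formula for \<open>Y\<close> splits off the groups,
  and the formula inside a group splits it into its members.
\<close>

lemma (in prob_space) indep_vars_nested:
  assumes outer: "indep_vars N Y I"
    and inner: "\<And>i. i \<in> I \<Longrightarrow> indep_vars (L i) (\<xi> i) (K i)"
    and f: "\<And>i k. i \<in> I \<Longrightarrow> k \<in> K i \<Longrightarrow> f i k \<in> measurable (N i) (L i k)"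
    and \<xi>: "\<And>i k \<omega>. i \<in> I \<Longrightarrow> k \<in> K i \<Longrightarrow> \<omega> \<in> space M \<Longrightarrow> \<xi> i k \<omega> = f i k (Y i \<omega>)"
  shows "indep_vars (\<lambda>(i, k). L i k) (\<lambda>(i, k). \<xi> i k) (SIGMA i:I. K i)"
  unfolding indep_vars_def2
proof (intro conjI ballI indep_setsI)
  let ?E = "\<lambda>x. {(case x of (i, k) \<Rightarrow> \<xi> i k) -` B \<inter> space M |B. B \<in> sets (case x of (i, k) \<Rightarrow> L i k)}"
  have rv: "\<xi> i k \<in> measurable M (L i k)" if "i \<in> I" "k \<in> K i" for i k
    using inner[OF that(1)] that(2) by (auto simp: indep_vars_def)
  { fix x assume "x \<in> (SIGMA i:I. K i)"
    then show "random_variable (case x of (i, k) \<Rightarrow> L i k) (case x of (i, k) \<Rightarrow> \<xi> i k)"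
      using rv by auto }
  { fix x assume "x \<in> (SIGMA i:I. K i)"
    then show "?E x \<subseteq> events" using rv by (auto intro!: measurable_sets) }
  fix B J assume J: "J \<noteq> {}" "J \<subseteq> (SIGMA i:I. K i)" "finite J" and B: "\<forall>x\<in>J. B x \<in> ?E x"
  define I' where "I' = fst ` J"
  define K' where "K' i = {k. (i, k) \<in> J}" for i
  have JS: "J = (SIGMA i:I'. K' i)" by (force simp: I'_def K'_def)
  have I': "finite I'" "I' \<noteq> {}" "I' \<subseteq> I" using J by (auto simp: I'_def)
  have K': "finite (K' i)" "K' i \<subseteq> K i" for i
  proof -
    have "K' i \<subseteq> snd ` J" by (force simp: K'_def)
    then show "finite (K' i)" using J(3) finite_subset by blast
    show "K' i \<subseteq> K i" using J(2) by (auto simp: K'_def)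
  qed
  have K'_ne: "K' i \<noteq> {}" if "i \<in> I'" for i using that by (auto simp: I'_def K'_def)
  have "\<forall>x\<in>J. \<exists>b. b \<in> sets (case x of (i, k) \<Rightarrow> L i k) \<and> B x = (case x of (i, k) \<Rightarrow> \<xi> i k) -` b \<inter> space M"
    using B by blast
  then obtain b where b: "\<And>i k. i \<in> I' \<Longrightarrow> k \<in> K' i \<Longrightarrow> b (i, k) \<in> sets (L i k)"
    "\<And>i k. i \<in> I' \<Longrightarrow> k \<in> K' i \<Longrightarrow> B (i, k) = \<xi> i k -` b (i, k) \<inter> space M"
    unfolding bchoice_iff by (force simp: JS)
  \<comment> \<open>The conjunction of all conditions in group \<open>i\<close>, as a condition on \<open>Y i\<close>.\<close>
  define C where "C i = (\<Inter>k\<in>K' i. f i k -` b (i, k) \<inter> space (N i))" for i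
  have C: "C i \<in> sets (N i)" if "i \<in> I'" for i
    unfolding C_def using that K' K'_ne I' b(1) by (intro sets.finite_INT measurable_sets[OF f]) auto
  have YC: "Y i -` C i \<inter> space M = (\<Inter>k\<in>K' i. B (i, k))" if i: "i \<in> I'" for i
  proof -
    have "Y i \<in> measurable M (N i)" using outer i I' by (auto simp: indep_vars_def)
    then have "Y i \<omega> \<in> space (N i)" if "\<omega> \<in> space M" for \<omega> using that by (rule measurable_space)
    then show ?thesis
      using K'_ne[OF i] i I'(3) K'(2)[of i] \<xi>[of i] by (auto simp: C_def b(2) subset_iff)
  qed
  have "prob (\<Inter>x\<in>J. B x) = prob (\<Inter>i\<in>I'. Y i -` C i \<inter> space M)"
    by (rule arg_cong[where f=prob]) (auto simp: JS YC)
  also have "\<dots> = (\<Prod>i\<in>I'. prob (Y i -` C i \<inter> space M))"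
    by (rule indep_varsD[OF outer I'(2,1,3) C])
  also have "\<dots> = (\<Prod>i\<in>I'. \<Prod>k\<in>K' i. prob (B (i, k)))"
  proof (intro prod.cong refl)
    fix i assume i: "i \<in> I'"
    have "prob (\<Inter>k\<in>K' i. \<xi> i k -` b (i, k) \<inter> space M) = (\<Prod>k\<in>K' i. prob (\<xi> i k -` b (i, k) \<inter> space M))"
      using i I'(3) K' K'_ne b(1) by (intro indep_varsD[OF inner]) auto
    then show "prob (Y i -` C i \<inter> space M) = (\<Prod>k\<in>K' i. prob (B (i, k)))"
      using i by (simp add: YC b(2) cong: INF_cong prod.cong)
  qed
  also have "\<dots> = (\<Prod>x\<in>J. prob (B x))"
    unfolding JS using I' K' by (subst prod.Sigma) (auto simp: case_prod_unfold)
  finally show "prob (\<Inter>x\<in>J. B x) = (\<Prod>x\<in>J. prob (B x))" .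
qed

text \<open>
  The factor \<open>(card I)\<^sup>2\<close> is a crude count of the pairs. It only multiplies \<open>b\<close>, which will be
  negligible.
\<close>

lemma (in prob_space) bonferroni_lower:
  assumes "finite I" "\<And>i. i \<in> I \<Longrightarrow> E i \<in> events" "0 \<le> b"
    and "\<And>i j. i \<in> I \<Longrightarrow> j \<in> I \<Longrightarrow> i \<noteq> j \<Longrightarrow> prob (E i \<inter> E j) \<le> b"
  shows "(\<Sum>i\<in>I. prob (E i)) \<le> prob (\<Union>i\<in>I. E i) + (real (card I))\<^sup>2 * b"
  using assms
proof (induction I rule: finite_induct)
  case (insert i I)
  let ?U = "\<Union>i\<in>I. E i"
  have U: "?U \<in> events" "E i \<in> events" using insert by auto
  have "E i \<inter> ?U = (\<Union>j\<in>I. E i \<inter> E j)" by auto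
  moreover have "prob (\<Union>j\<in>I. E i \<inter> E j) \<le> (\<Sum>j\<in>I. prob (E i \<inter> E j))"
    by (rule measure_UNION_le) (use insert.hyps(1) insert.prems(1) in auto)
  moreover have "(\<Sum>j\<in>I. prob (E i \<inter> E j)) \<le> (\<Sum>j\<in>I. b)"
    by (rule sum_mono) (use insert.hyps(2) insert.prems(3) in auto)
  ultimately have "prob (E i \<inter> ?U) \<le> (\<Sum>j\<in>I. b)" by (simp only:)
  then have "prob (E i \<inter> ?U) \<le> real (card I) * b" by simp
  moreover have "prob (E i \<union> ?U) = prob (E i) + prob ?U - prob (E i \<inter> ?U)"
    using measure_Un3[of "E i" M ?U] U by (simp add: fmeasurable_eq_sets)
  moreover have "(\<Sum>i\<in>I. prob (E i)) \<le> prob ?U + (real (card I))\<^sup>2 * b"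
    using insert by auto
  moreover have "real (card I) * b + (real (card I))\<^sup>2 * b \<le> (real (Suc (card I)))\<^sup>2 * b"
    using insert.prems(2) by (auto simp: power2_eq_square algebra_simps)
  ultimately show ?case using insert by simp
qed simp

section \<open>Gaussian walks with common steps\<close>

text \<open>
  Several walks that draw their steps from one independent family: walk \<open>\<gamma>\<close> takes the steps
  \<open>\<xi> (a \<gamma> 0)\<close>, \<open>\<xi> (a \<gamma> 1)\<close>, and so on, so two walks have a step in common exactly if their index
  functions share a value. Since the variance of a step is the length of its time interval, each walk
  has the law of a Brownian motion at the grid times \<open>t 0, \<dots>, t m\<close>, and \<open>t m\<close> is the time horizon.
  The number \<open>c\<close> is the drift that is subtracted.
\<close>

locale gaussian_walks = prob_space M for M :: "'a measure" +
  fixes A :: "'i set" and \<xi> :: "'i \<Rightarrow> 'a \<Rightarrow> real" and \<Gamma> :: "'g set"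
    and a :: "'g \<Rightarrow> nat \<Rightarrow> 'i" and m :: nat and t :: "nat \<Rightarrow> real" and c :: real
  assumes finite_\<Gamma>: "finite \<Gamma>"
    and m_pos: "0 < m"
    and t_0: "t 0 = 0"
    and t_step: "k < m \<Longrightarrow> t k < t (Suc k)"
    and indep: "indep_vars (\<lambda>_. borel) \<xi> A"
    and inj: "\<gamma> \<in> \<Gamma> \<Longrightarrow> inj_on (a \<gamma>) {..<m}"
    and index: "\<gamma> \<in> \<Gamma> \<Longrightarrow> k < m \<Longrightarrow> a \<gamma> k \<in> A"
    and normal: "\<gamma> \<in> \<Gamma> \<Longrightarrow> k < m \<Longrightarrow>
      distributed M lborel (\<xi> (a \<gamma> k)) (normal_density 0 (sqrt (t (Suc k) - t k)))"
begin

definition S :: "'g \<Rightarrow> nat \<Rightarrow> 'a \<Rightarrow> real" where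
  "S \<gamma> k \<omega> = (\<Sum>j<k. \<xi> (a \<gamma> j) \<omega>)"

definition Y :: "'g \<Rightarrow> nat \<Rightarrow> 'a \<Rightarrow> real" where
  "Y \<gamma> k \<omega> = S \<gamma> k \<omega> - c * t k"

lemma measurable_\<xi> [measurable (raw)]: "i \<in> A \<Longrightarrow> \<xi> i \<in> borel_measurable M"
  using indep by (auto simp: indep_vars_def)

lemma measurable_S: "\<gamma> \<in> \<Gamma> \<Longrightarrow> k \<le> m \<Longrightarrow> S \<gamma> k \<in> borel_measurable M"
  unfolding S_def by (intro borel_measurable_sum measurable_\<xi> index) auto

lemma measurable_Y: "\<gamma> \<in> \<Gamma> \<Longrightarrow> k \<le> m \<Longrightarrow> Y \<gamma> k \<in> borel_measurable M"
  unfolding Y_def using measurable_S by measurable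

lemma t_strict_mono: "j < k \<Longrightarrow> k \<le> m \<Longrightarrow> t j < t k"
proof (induction k)
  case (Suc k)
  then have "t k < t (Suc k)" using t_step[of k] by simp
  then show ?case using Suc by (cases "j = k") auto
qed simp

lemma t_mono: "j \<le> k \<Longrightarrow> k \<le> m \<Longrightarrow> t j \<le> t k"
  using t_strict_mono[of j k] by (cases "j = k") auto

lemma t_nonneg: "k \<le> m \<Longrightarrow> 0 \<le> t k"
  using t_mono[of 0 k] t_0 by simp

lemma S_diff:
  assumes "j \<le> k"
  shows "S \<gamma> k \<omega> - S \<gamma> j \<omega> = (\<Sum>i\<in>{j..<k}. \<xi> (a \<gamma> i) \<omega>)"
proof -
  have "{..<k} = {..<j} \<union> {j..<k}" using assms by auto
  moreover have "{..<j} \<inter> {j..<k} = {}" by auto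
  ultimately show ?thesis
    using sum.union_disjoint[of "{..<j}" "{j..<k}" "\<lambda>i. \<xi> (a \<gamma> i) \<omega>"] by (simp add: S_def)
qed

lemma sum_squares_steps:
  assumes "j \<le> k" "k \<le> m"
  shows "(\<Sum>i\<in>{j..<k}. (sqrt (t (Suc i) - t i))\<^sup>2) = t k - t j"
proof -
  have "(\<Sum>i\<in>{j..<k}. (sqrt (t (Suc i) - t i))\<^sup>2) = (\<Sum>i\<in>{j..<k}. t (Suc i) - t i)"
    using assms t_step by (intro sum.cong refl) (auto simp: less_imp_le)
  also have "\<dots> = t k - t j" using assms(1) by (rule sum_Suc_diff')
  finally show ?thesis .
qed

lemma indep_steps: "\<gamma> \<in> \<Gamma> \<Longrightarrow> I \<subseteq> {..<m} \<Longrightarrow> indep_vars (\<lambda>_. borel) (\<lambda>i. \<xi> (a \<gamma> i)) I"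
  using indep_vars_reindex[OF indep, of "a \<gamma>" I] inj[of \<gamma>] index[of \<gamma>] by (auto intro: inj_on_subset)

lemma increment_normal:
  assumes "\<gamma> \<in> \<Gamma>" "j < k" "k \<le> m"
  shows "distributed M lborel (\<lambda>\<omega>. S \<gamma> k \<omega> - S \<gamma> j \<omega>) (normal_density 0 (sqrt (t k - t j)))"
proof -
  have "distributed M lborel (\<lambda>\<omega>. \<Sum>i\<in>{j..<k}. \<xi> (a \<gamma> i) \<omega>)
    (normal_density (\<Sum>i\<in>{j..<k}. 0) (sqrt (\<Sum>i\<in>{j..<k}. (sqrt (t (Suc i) - t i))\<^sup>2)))"
    using assms t_step by (intro sum_indep_normal indep_steps normal) auto
  then show ?thesis using assms by (simp add: S_diff sum_squares_steps)
qed

lemma prob_end_gt: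
  assumes "\<gamma> \<in> \<Gamma>" "0 < k" "k \<le> m"
  shows "prob {\<omega> \<in> space M. u < Y \<gamma> k \<omega>} = gaussian_tail ((u + c * t k) / sqrt (t k))"
proof -
  have "distributed M lborel (S \<gamma> k) (normal_density 0 (sqrt (t k)))"
  proof -
    have "S \<gamma> k = (\<lambda>\<omega>. S \<gamma> k \<omega> - S \<gamma> 0 \<omega>)" by (simp add: S_def fun_eq_iff)
    then show ?thesis using increment_normal[OF assms] t_0 by simp
  qed
  moreover have "0 < t k" using t_strict_mono[of 0 k] assms t_0 by simp
  ultimately have "prob {\<omega> \<in> space M. u + c * t k < S \<gamma> k \<omega>} = gaussian_tail ((u + c * t k) / sqrt (t k))"
    by (intro normal_upper_tail) auto
  then show ?thesis by (simp add: Y_def less_diff_eq)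
qed

section \<open>First passages\<close>

text \<open>
  Passages are counted from time \<open>k0\<close> on. Starting late confines the first passage
  to the end of the time interval, where the drift hardly matters.
\<close>

definition first_passage :: "'g \<Rightarrow> real \<Rightarrow> nat \<Rightarrow> nat \<Rightarrow> 'a \<Rightarrow> bool" where
  "first_passage \<gamma> u k0 k \<omega> \<longleftrightarrow> u < Y \<gamma> k \<omega> \<and> (\<forall>j\<in>{k0..<k}. Y \<gamma> j \<omega> \<le> u)"

lemma first_passage_iff:
  "(\<exists>k\<in>{k0..l}. u < Y \<gamma> k \<omega>) \<longleftrightarrow> (\<exists>k\<in>{k0..l}. first_passage \<gamma> u k0 k \<omega>)"
proof
  assume "\<exists>k\<in>{k0..l}. u < Y \<gamma> k \<omega>"
  then have ex: "\<exists>k. k \<in> {k0..l} \<and> u < Y \<gamma> k \<omega>" by blast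
  define k where "k = (LEAST k. k \<in> {k0..l} \<and> u < Y \<gamma> k \<omega>)"
  have k: "k \<in> {k0..l}" "u < Y \<gamma> k \<omega>" using LeastI_ex[OF ex] by (auto simp: k_def)
  have "Y \<gamma> j \<omega> \<le> u" if "j \<in> {k0..<k}" for j
    using not_less_Least[of j "\<lambda>k. k \<in> {k0..l} \<and> u < Y \<gamma> k \<omega>"] that k(1)
    unfolding k_def[symmetric] by auto
  with k show "\<exists>k\<in>{k0..l}. first_passage \<gamma> u k0 k \<omega>" by (auto simp: first_passage_def)
qed (auto simp: first_passage_def)

lemma first_passage_unique:
  "first_passage \<gamma> u k0 j \<omega> \<Longrightarrow> first_passage \<gamma> u k0 k \<omega> \<Longrightarrow> k0 \<le> j \<Longrightarrow> k0 \<le> k \<Longrightarrow> j = k"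
  by (cases j k rule: linorder_cases) (force simp: first_passage_def)+

lemma measurable_first_passage:
  "\<gamma> \<in> \<Gamma> \<Longrightarrow> k \<le> m \<Longrightarrow> Measurable.pred M (first_passage \<gamma> u k0 k)"
proof -
  assume g: "\<gamma> \<in> \<Gamma>" and k: "k \<le> m"
  have [measurable]: "Y \<gamma> k \<in> borel_measurable M" using g k by (rule measurable_Y)
  have [measurable]: "j \<in> {k0..<k} \<Longrightarrow> Y \<gamma> j \<in> borel_measurable M" for j
    using g k by (intro measurable_Y) auto
  show ?thesis unfolding first_passage_def by measurable
qed

lemma measurable_nuisance:
  assumes "D \<subseteq> A" "Measurable.pred (PiM D (\<lambda>_. borel)) q"
  shows "Measurable.pred M (\<lambda>\<omega>. q (\<lambda>i\<in>D. \<xi> i \<omega>))"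
  using assms by (intro measurable_compose[OF _ assms(2)] measurable_restrict measurable_\<xi>) auto

text \<open>
  The first passage at \<open>k\<close> is determined by the steps before \<open>k\<close>, the increment from \<open>k\<close> to \<open>l\<close> by
  those after it. The event \<open>q\<close> is a further event on steps that the walk does not take after \<open>k0\<close>;
  it will express that another walk of the family reaches the level or ends above it.
\<close>

lemma first_passage_indep:
  assumes "\<gamma> \<in> \<Gamma>" "k0 \<le> k" "k \<le> l" "l \<le> m"
    and "D \<subseteq> A" "D \<inter> a \<gamma> ` {k0..<l} = {}" and q: "Measurable.pred (PiM D (\<lambda>_. borel)) q"
    and B: "B \<in> sets borel"
  shows "prob {\<omega> \<in> space M. (q (\<lambda>i\<in>D. \<xi> i \<omega>) \<and> first_passage \<gamma> u k0 k \<omega>) \<and> S \<gamma> l \<omega> - S \<gamma> k \<omega> \<in> B}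
    = prob {\<omega> \<in> space M. q (\<lambda>i\<in>D. \<xi> i \<omega>) \<and> first_passage \<gamma> u k0 k \<omega>}
      * prob {\<omega> \<in> space M. S \<gamma> l \<omega> - S \<gamma> k \<omega> \<in> B}"
proof -
  let ?A = "D \<union> a \<gamma> ` {..<k}" and ?R = "a \<gamma> ` {k..<l}"
  \<comment> \<open>Both events have to be written as conditions on disjoint blocks of the family \<open>\<xi>\<close>.\<close>
  define s :: "nat \<Rightarrow> ('i \<Rightarrow> real) \<Rightarrow> real" where "s j x = (\<Sum>i<j. x (a \<gamma> i)) - c * t j" for j x
  define p where "p x \<longleftrightarrow> q (restrict x D) \<and> u < s k x \<and> (\<forall>j\<in>{k0..<k}. s j x \<le> u)" for x
  define r where "r x \<longleftrightarrow> (\<Sum>i\<in>{k..<l}. x (a \<gamma> i)) \<in> B" for x :: "'i \<Rightarrow> real"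
  have s: "s j \<in> borel_measurable (PiM ?A (\<lambda>_. borel))" if "j \<le> k" for j
    unfolding s_def using that
    by (intro borel_measurable_diff borel_measurable_sum borel_measurable_const measurable_component_singleton) auto
  have [measurable]: "s k \<in> borel_measurable (PiM ?A (\<lambda>_. borel))" by (rule s) simp
  have [measurable]: "j \<in> {k0..<k} \<Longrightarrow> s j \<in> borel_measurable (PiM ?A (\<lambda>_. borel))" for j
    by (rule s) auto
  have [measurable]: "Measurable.pred (PiM ?A (\<lambda>_. borel)) (\<lambda>x. q (restrict x D))"
    by (rule measurable_compose[OF measurable_restrict_subset q]) auto
  have "Measurable.pred (PiM ?A (\<lambda>_. borel)) p"
    unfolding p_def by measurable
  moreover have "(\<lambda>x. \<Sum>i\<in>{k..<l}. x (a \<gamma> i) :: real) \<in> borel_measurable (PiM ?R (\<lambda>_. borel))"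
    by (intro borel_measurable_sum measurable_component_singleton) auto
  then have "Measurable.pred (PiM ?R (\<lambda>_. borel)) r"
    unfolding r_def using B by measurable
  moreover have "?A \<inter> ?R = {}"
  proof -
    have "a \<gamma> i \<noteq> a \<gamma> j" if "i < k" "j \<in> {k..<l}" for i j
      using inj_onD[OF inj[OF assms(1)], of i j] that assms(3,4) by auto
    moreover have "D \<inter> ?R = {}" using assms(2,6) by fastforce
    ultimately show ?thesis by blast
  qed
  ultimately have "prob {\<omega> \<in> space M. p (\<lambda>i\<in>?A. \<xi> i \<omega>) \<and> r (\<lambda>i\<in>?R. \<xi> i \<omega>)}
    = prob {\<omega> \<in> space M. p (\<lambda>i\<in>?A. \<xi> i \<omega>)} * prob {\<omega> \<in> space M. r (\<lambda>i\<in>?R. \<xi> i \<omega>)}"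
    using assms(1,3-5) index by (intro indep_vars_disjoint_blocks[OF indep]) auto
  moreover have "r (\<lambda>i\<in>?R. \<xi> i \<omega>) \<longleftrightarrow> S \<gamma> l \<omega> - S \<gamma> k \<omega> \<in> B" for \<omega>
    by (simp add: r_def S_diff[OF assms(3)])
  moreover have "p (\<lambda>i\<in>?A. \<xi> i \<omega>) \<longleftrightarrow> q (\<lambda>i\<in>D. \<xi> i \<omega>) \<and> first_passage \<gamma> u k0 k \<omega>" for \<omega>
  proof -
    have "s j (\<lambda>i\<in>?A. \<xi> i \<omega>) = Y \<gamma> j \<omega>" if "j \<le> k" for j
      using that by (auto simp: s_def Y_def S_def intro!: sum.cong)
    moreover have "restrict (\<lambda>i\<in>?A. \<xi> i \<omega>) D = (\<lambda>i\<in>D. \<xi> i \<omega>)"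
      by (auto simp: restrict_def)
    ultimately show ?thesis by (auto simp: p_def first_passage_def)
  qed
  ultimately show ?thesis by simp
qed

text \<open>
  The events of a first passage at \<open>k\<close> are disjoint for different \<open>k\<close>. This is the discrete form of
  the strong Markov property at the first passage time.
\<close>

lemma first_passage_sum:
  assumes "\<gamma> \<in> \<Gamma>" "k0 \<le> l" "l \<le> m"
    and "D \<subseteq> A" "D \<inter> a \<gamma> ` {k0..<l} = {}" and q: "Measurable.pred (PiM D (\<lambda>_. borel)) q"
    and B: "\<And>k. B k \<in> sets borel"
  shows "prob {\<omega> \<in> space M. q (\<lambda>i\<in>D. \<xi> i \<omega>)
        \<and> (\<exists>k\<in>{k0..l}. first_passage \<gamma> u k0 k \<omega> \<and> S \<gamma> l \<omega> - S \<gamma> k \<omega> \<in> B k)}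
    = (\<Sum>k\<in>{k0..l}. prob {\<omega> \<in> space M. q (\<lambda>i\<in>D. \<xi> i \<omega>) \<and> first_passage \<gamma> u k0 k \<omega>}
      * prob {\<omega> \<in> space M. S \<gamma> l \<omega> - S \<gamma> k \<omega> \<in> B k})"
proof -
  let ?E = "\<lambda>k. {\<omega> \<in> space M. (q (\<lambda>i\<in>D. \<xi> i \<omega>) \<and> first_passage \<gamma> u k0 k \<omega>) \<and> S \<gamma> l \<omega> - S \<gamma> k \<omega> \<in> B k}"
  have E: "?E k \<in> events" if "k \<in> {k0..l}" for k
  proof -
    have [measurable]: "Measurable.pred M (first_passage \<gamma> u k0 k)" "S \<gamma> l \<in> borel_measurable M"
      "S \<gamma> k \<in> borel_measurable M" "Measurable.pred M (\<lambda>\<omega>. q (\<lambda>i\<in>D. \<xi> i \<omega>))"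
      using assms that by (auto intro!: measurable_first_passage measurable_S measurable_nuisance)
    show ?thesis using B[of k] by measurable
  qed
  have "prob (\<Union>k\<in>{k0..l}. ?E k) = (\<Sum>k\<in>{k0..l}. prob (?E k))"
    using E first_passage_unique[of \<gamma> u k0]
    by (intro finite_measure_finite_Union) (auto simp: disjoint_family_on_def)
  also have "\<dots> = (\<Sum>k\<in>{k0..l}. prob {\<omega> \<in> space M. q (\<lambda>i\<in>D. \<xi> i \<omega>) \<and> first_passage \<gamma> u k0 k \<omega>}
      * prob {\<omega> \<in> space M. S \<gamma> l \<omega> - S \<gamma> k \<omega> \<in> B k})"
    using assms by (intro sum.cong refl first_passage_indep) auto
  also have "(\<Union>k\<in>{k0..l}. ?E k) = {\<omega> \<in> space M. q (\<lambda>i\<in>D. \<xi> i \<omega>)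
        \<and> (\<exists>k\<in>{k0..l}. first_passage \<gamma> u k0 k \<omega> \<and> S \<gamma> l \<omega> - S \<gamma> k \<omega> \<in> B k)}"
    by auto
  finally show ?thesis .
qed

lemma passage_sum:
  assumes "\<gamma> \<in> \<Gamma>" "k0 \<le> l" "l \<le> m"
    and "D \<subseteq> A" "D \<inter> a \<gamma> ` {k0..<l} = {}" and q: "Measurable.pred (PiM D (\<lambda>_. borel)) q"
  shows "prob {\<omega> \<in> space M. q (\<lambda>i\<in>D. \<xi> i \<omega>) \<and> (\<exists>k\<in>{k0..l}. u < Y \<gamma> k \<omega>)}
    = (\<Sum>k\<in>{k0..l}. prob {\<omega> \<in> space M. q (\<lambda>i\<in>D. \<xi> i \<omega>) \<and> first_passage \<gamma> u k0 k \<omega>})"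
  using first_passage_sum[OF assms, of "\<lambda>_. UNIV" u] by (simp add: first_passage_iff prob_space)

text \<open>
  A walk that has passed \<open>u\<close> at time \<open>k\<close> ends above \<open>u\<close> if its remaining increment makes up for the
  remaining drift. That has probability \<open>\<Psi> (c \<surd>r)\<close> for the remaining time \<open>r\<close>, hence at least \<open>\<alpha>\<close>.
\<close>

lemma passage_imp_end:
  assumes "\<gamma> \<in> \<Gamma>" "k0 \<le> l" "l \<le> m"
    and "D \<subseteq> A" "D \<inter> a \<gamma> ` {k0..<l} = {}" and q: "Measurable.pred (PiM D (\<lambda>_. borel)) q"
    and \<alpha>: "\<alpha> \<le> gaussian_tail (\<bar>c\<bar> * sqrt (t l - t k0))"
  shows "\<alpha> * prob {\<omega> \<in> space M. q (\<lambda>i\<in>D. \<xi> i \<omega>) \<and> (\<exists>k\<in>{k0..l}. u < Y \<gamma> k \<omega>)}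
    \<le> prob {\<omega> \<in> space M. q (\<lambda>i\<in>D. \<xi> i \<omega>) \<and> u < Y \<gamma> l \<omega>}"
proof -
  let ?B = "\<lambda>k. {c * (t l - t k)..}"
  let ?F = "\<lambda>k. prob {\<omega> \<in> space M. q (\<lambda>i\<in>D. \<xi> i \<omega>) \<and> first_passage \<gamma> u k0 k \<omega>}"
  have step: "\<alpha> \<le> prob {\<omega> \<in> space M. S \<gamma> l \<omega> - S \<gamma> k \<omega> \<in> ?B k}" if k: "k \<in> {k0..l}" for k
  proof (cases "k = l")
    case True
    have "gaussian_tail x \<le> 1" for x
      unfolding gaussian_tail_def using prob_space_std_normal by (rule prob_space.prob_le_1)
    then show ?thesis using True \<alpha> prob_space by (auto intro: order_trans)
  next
    case False
    with k have "k < l" by simp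
    with assms(3) have r: "0 < t l - t k" using t_strict_mono[of k l] by simp
    have "prob {\<omega> \<in> space M. S \<gamma> l \<omega> - S \<gamma> k \<omega> \<ge> c * (t l - t k)}
        = gaussian_tail (c * (t l - t k) / sqrt (t l - t k))"
      using r by (intro normal_upper_tail_closed increment_normal assms \<open>k < l\<close>) auto
    also have "c * (t l - t k) / sqrt (t l - t k) = c * sqrt (t l - t k)"
      using r real_div_sqrt[of "t l - t k"] by (metis less_imp_le times_divide_eq_right)
    also have "gaussian_tail (\<bar>c\<bar> * sqrt (t l - t k0)) \<le> gaussian_tail (c * sqrt (t l - t k))"
      using k r assms(3) t_mono[of k0 k] by (intro gaussian_tail_antimono mult_mono) auto
    finally show ?thesis using \<alpha> by simp
  qed
  have [measurable]: "Y \<gamma> l \<in> borel_measurable M" "Measurable.pred M (\<lambda>\<omega>. q (\<lambda>i\<in>D. \<xi> i \<omega>))"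
    using assms by (auto intro!: measurable_Y measurable_nuisance)
  have "\<alpha> * prob {\<omega> \<in> space M. q (\<lambda>i\<in>D. \<xi> i \<omega>) \<and> (\<exists>k\<in>{k0..l}. u < Y \<gamma> k \<omega>)}
      = (\<Sum>k\<in>{k0..l}. ?F k * \<alpha>)"
    by (simp add: passage_sum[OF assms(1-6)] sum_distrib_left mult.commute)
  also have "\<dots> \<le> (\<Sum>k\<in>{k0..l}. ?F k * prob {\<omega> \<in> space M. S \<gamma> l \<omega> - S \<gamma> k \<omega> \<in> ?B k})"
    using step by (intro sum_mono mult_left_mono) auto
  also have "\<dots> = prob {\<omega> \<in> space M. q (\<lambda>i\<in>D. \<xi> i \<omega>)
        \<and> (\<exists>k\<in>{k0..l}. first_passage \<gamma> u k0 k \<omega> \<and> S \<gamma> l \<omega> - S \<gamma> k \<omega> \<in> ?B k)}"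
    using assms by (intro first_passage_sum[symmetric]) auto
  also have "\<dots> \<le> prob {\<omega> \<in> space M. q (\<lambda>i\<in>D. \<xi> i \<omega>) \<and> u < Y \<gamma> l \<omega>}"
  proof (rule finite_measure_mono)
    show "{\<omega> \<in> space M. q (\<lambda>i\<in>D. \<xi> i \<omega>) \<and> u < Y \<gamma> l \<omega>} \<in> events" by measurable
  qed (auto simp: first_passage_def Y_def algebra_simps)
  finally show ?thesis .
qed

section \<open>One walk reaching a high level\<close>

definition hits :: "'g \<Rightarrow> real \<Rightarrow> nat \<Rightarrow> nat \<Rightarrow> 'a set" where
  "hits \<gamma> u j l = {\<omega> \<in> space M. \<exists>k\<in>{j..l}. u < Y \<gamma> k \<omega>}"

lemma hits_events: "\<gamma> \<in> \<Gamma> \<Longrightarrow> l \<le> m \<Longrightarrow> hits \<gamma> u j l \<in> events"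
proof -
  assume g: "\<gamma> \<in> \<Gamma>" and l: "l \<le> m"
  have [measurable]: "k \<in> {j..l} \<Longrightarrow> Y \<gamma> k \<in> borel_measurable M" for k
    using g l by (intro measurable_Y) auto
  show ?thesis unfolding hits_def by measurable
qed

lemma horizon_pos: "0 < t m"
  using t_strict_mono[of 0 m] m_pos t_0 by simp

lemma prob_end_le:
  assumes "\<gamma> \<in> \<Gamma>" "k \<le> m" "t k \<le> s" "0 < s" "\<bar>c\<bar> * t m \<le> u"
  shows "prob {\<omega> \<in> space M. u < Y \<gamma> k \<omega>} \<le> gaussian_tail ((u - \<bar>c\<bar> * t m) / sqrt s)"
proof (cases "k = 0")
  case True
  have "0 \<le> \<bar>c\<bar> * t m" using horizon_pos by simp
  then have "{\<omega> \<in> space M. u < Y \<gamma> k \<omega>} = {}" using assms(5) True by (auto simp: Y_def S_def t_0)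
  then show ?thesis by (simp only: measure_empty gaussian_tail_nonneg)
next
  case False
  then have t: "0 < t k" using t_strict_mono[of 0 k] assms t_0 by simp
  have "- (\<bar>c\<bar> * t m) \<le> - (\<bar>c\<bar> * t k)" using t_mono[of k m] assms by (simp add: mult_left_mono)
  also have "- (\<bar>c\<bar> * t k) \<le> c * t k" using t mult_right_mono[OF abs_ge_minus_self[of c], of "t k"] by simp
  finally have "u - \<bar>c\<bar> * t m \<le> u + c * t k" by simp
  then have "(u - \<bar>c\<bar> * t m) / sqrt s \<le> (u + c * t k) / sqrt (t k)"
    using assms t by (intro frac_le) auto
  then show ?thesis
    using prob_end_gt[of \<gamma> k u] assms False by (simp add: gaussian_tail_antimono)
qed

text \<open>
  For passages that are not close to the end, a constant factor is good enough: the right-hand side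
  has the smaller variance \<open>s\<close> and will be negligible.
\<close>

lemma early_hit_le:
  assumes "\<gamma> \<in> \<Gamma>" "k0 \<le> m" "t k0 \<le> s" "0 < s" "\<bar>c\<bar> * t m \<le> u"
  shows "prob (hits \<gamma> u 0 k0) \<le> gaussian_tail ((u - \<bar>c\<bar> * t m) / sqrt s) / gaussian_tail (\<bar>c\<bar> * sqrt (t m))"
proof -
  have "gaussian_tail (\<bar>c\<bar> * sqrt (t m)) * prob {\<omega> \<in> space M. True \<and> (\<exists>k\<in>{0..k0}. u < Y \<gamma> k \<omega>)}
      \<le> prob {\<omega> \<in> space M. True \<and> u < Y \<gamma> k0 \<omega>}"
  proof (rule passage_imp_end[where D="{}" and q="\<lambda>_. True"])
    show "gaussian_tail (\<bar>c\<bar> * sqrt (t m)) \<le> gaussian_tail (\<bar>c\<bar> * sqrt (t k0 - t 0))"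
      using t_mono[OF assms(2) order.refl] t_0 by (intro gaussian_tail_antimono mult_left_mono) auto
  qed (use assms in auto)
  also have "\<dots> \<le> gaussian_tail ((u - \<bar>c\<bar> * t m) / sqrt s)"
    using prob_end_le[OF assms] by simp
  finally have "prob (hits \<gamma> u 0 k0) * gaussian_tail (\<bar>c\<bar> * sqrt (t m)) \<le> gaussian_tail ((u - \<bar>c\<bar> * t m) / sqrt s)"
    unfolding hits_def by (simp only: simp_thms mult.commute)
  then show ?thesis
    unfolding pos_le_divide_eq[OF gaussian_tail_pos] .
qed

lemma hit_split_le:
  assumes "\<gamma> \<in> \<Gamma>" "k0 \<le> m"
  shows "prob (hits \<gamma> u 0 m) \<le> prob (hits \<gamma> u 0 k0) + prob (hits \<gamma> u k0 m)"
proof -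
  have "hits \<gamma> u 0 m \<subseteq> hits \<gamma> u 0 k0 \<union> hits \<gamma> u k0 m"
    by (fastforce simp: hits_def)
  then have "prob (hits \<gamma> u 0 m) \<le> prob (hits \<gamma> u 0 k0 \<union> hits \<gamma> u k0 m)"
    using assms by (intro finite_measure_mono) (auto intro!: hits_events)
  also have "\<dots> \<le> prob (hits \<gamma> u 0 k0) + prob (hits \<gamma> u k0 m)"
    using assms by (intro measure_Un_le hits_events) auto
  finally show ?thesis .
qed

text \<open>
  The window from \<open>k0\<close> to \<open>m\<close> has length at most \<open>d\<close>, so \<open>\<Psi> (\<bar>c\<bar> \<surd>d)\<close> is close to \<open>1/2\<close> for small \<open>d\<close>
  and the main term is close to \<open>2 g u\<close>.
\<close>

lemma walk_hit_upper:
  assumes "\<gamma> \<in> \<Gamma>" "k0 \<le> m" "t k0 \<le> s" "0 < s" "\<bar>c\<bar> * t m \<le> u" "t m - t k0 \<le> d"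
  shows "prob (hits \<gamma> u 0 m) \<le> gaussian_tail ((u - \<bar>c\<bar> * t m) / sqrt s) / gaussian_tail (\<bar>c\<bar> * sqrt (t m))
    + gaussian_tail ((u + c * t m) / sqrt (t m)) / gaussian_tail (\<bar>c\<bar> * sqrt d)"
proof -
  have "gaussian_tail (\<bar>c\<bar> * sqrt d) * prob {\<omega> \<in> space M. True \<and> (\<exists>k\<in>{k0..m}. u < Y \<gamma> k \<omega>)}
      \<le> prob {\<omega> \<in> space M. True \<and> u < Y \<gamma> m \<omega>}"
  proof (rule passage_imp_end[where D="{}" and q="\<lambda>_. True"])
    show "gaussian_tail (\<bar>c\<bar> * sqrt d) \<le> gaussian_tail (\<bar>c\<bar> * sqrt (t m - t k0))"
      using assms(6) by (intro gaussian_tail_antimono mult_left_mono) auto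
  qed (use assms in auto)
  also have "\<dots> = gaussian_tail ((u + c * t m) / sqrt (t m))"
    using prob_end_gt[OF assms(1) m_pos] by simp
  finally have "prob (hits \<gamma> u k0 m) * gaussian_tail (\<bar>c\<bar> * sqrt d) \<le> gaussian_tail ((u + c * t m) / sqrt (t m))"
    unfolding hits_def by (simp only: simp_thms mult.commute)
  then have "prob (hits \<gamma> u k0 m) \<le> gaussian_tail ((u + c * t m) / sqrt (t m)) / gaussian_tail (\<bar>c\<bar> * sqrt d)"
    unfolding pos_le_divide_eq[OF gaussian_tail_pos] .
  then show ?thesis using hit_split_le[OF assms(1,2), of u] early_hit_le[OF assms(1-5)] by linarith
qed

text \<open>
  Away from this event, a first passage after the start of a window exceeds the level by at most \<open>\<epsilon>\<close>.
\<close>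

definition overshoot :: "'g \<Rightarrow> real \<Rightarrow> 'a set" where
  "overshoot \<gamma> \<epsilon> = {\<omega> \<in> space M. \<exists>k<m. Y \<gamma> (Suc k) \<omega> - Y \<gamma> k \<omega> > \<epsilon>}"

lemma overshoot_events: "\<gamma> \<in> \<Gamma> \<Longrightarrow> overshoot \<gamma> \<epsilon> \<in> events"
proof -
  assume g: "\<gamma> \<in> \<Gamma>"
  have [measurable]: "k \<in> {..<m} \<Longrightarrow> Y \<gamma> k \<in> borel_measurable M" "k \<in> {..<m} \<Longrightarrow> Y \<gamma> (Suc k) \<in> borel_measurable M" for k
    using g by (auto intro!: measurable_Y)
  have "overshoot \<gamma> \<epsilon> = {\<omega> \<in> space M. \<exists>k\<in>{..<m}. Y \<gamma> (Suc k) \<omega> - Y \<gamma> k \<omega> > \<epsilon>}"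
    by (auto simp: overshoot_def)
  also have "\<dots> \<in> events" by measurable
  finally show ?thesis .
qed

text \<open>
  The drift takes up at most half of \<open>\<epsilon>\<close>, so the centred step exceeds \<open>\<epsilon> / 2\<close>. The constant is
  \<open>128 = 8 \<cdot> 2\<^sup>4\<close>, with 8 from \<open>gaussian_tail_power4\<close>.
\<close>

lemma overshoot_le:
  assumes "\<gamma> \<in> \<Gamma>" "0 < \<epsilon>" "\<And>k. k < m \<Longrightarrow> t (Suc k) - t k \<le> h"
    and h: "\<bar>c\<bar> * h \<le> \<epsilon> / 2" "2 * sqrt h \<le> \<epsilon>"
  shows "prob (overshoot \<gamma> \<epsilon>) \<le> 128 * t m * h / \<epsilon> ^ 4"
proof -
  let ?E = "\<lambda>k. {\<omega> \<in> space M. Y \<gamma> (Suc k) \<omega> - Y \<gamma> k \<omega> > \<epsilon>}"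
  have step: "prob (?E k) \<le> (t (Suc k) - t k) * (128 * h / \<epsilon> ^ 4)" if k: "k < m" for k
  proof -
    define \<Delta> where "\<Delta> = t (Suc k) - t k"
    have \<Delta>: "0 < \<Delta>" "\<Delta> \<le> h" using t_step[OF k] assms(3)[OF k] by (auto simp: \<Delta>_def)
    have "?E k = {\<omega> \<in> space M. S \<gamma> (Suc k) \<omega> - S \<gamma> k \<omega> > \<epsilon> + c * \<Delta>}"
      by (auto simp: Y_def \<Delta>_def algebra_simps)
    then have "prob (?E k) = gaussian_tail ((\<epsilon> + c * \<Delta>) / sqrt \<Delta>)"
      using normal_upper_tail[OF increment_normal[OF assms(1), of k "Suc k"]] k \<Delta> by (simp add: \<Delta>_def)
    also have "\<dots> \<le> gaussian_tail (\<epsilon> / (2 * sqrt \<Delta>))"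
    proof (rule gaussian_tail_antimono)
      have "- (c * \<Delta>) \<le> \<bar>c\<bar> * \<Delta>" using \<Delta> mult_right_mono[OF abs_ge_minus_self[of c], of \<Delta>] by simp
      also have "\<dots> \<le> \<bar>c\<bar> * h" using \<Delta> by (intro mult_left_mono) auto
      finally have "\<epsilon> / 2 \<le> \<epsilon> + c * \<Delta>" using h(1) by simp
      then have "(\<epsilon> / 2) / sqrt \<Delta> \<le> (\<epsilon> + c * \<Delta>) / sqrt \<Delta>" using \<Delta> by (intro divide_right_mono) auto
      then show "\<epsilon> / (2 * sqrt \<Delta>) \<le> (\<epsilon> + c * \<Delta>) / sqrt \<Delta>" by simp
    qed
    also have "\<dots> \<le> 8 / (\<epsilon> / (2 * sqrt \<Delta>)) ^ 4"
    proof (rule gaussian_tail_power4)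
      have "2 * sqrt \<Delta> \<le> \<epsilon>" using h(2) real_sqrt_le_mono[OF \<Delta>(2)] by linarith
      then show "1 \<le> \<epsilon> / (2 * sqrt \<Delta>)" using \<Delta> by (simp add: pos_le_divide_eq)
    qed
    also have "\<dots> = \<Delta> * (128 * \<Delta> / \<epsilon> ^ 4)"
    proof -
      have "sqrt \<Delta> ^ 4 = \<Delta> * \<Delta>"
        using \<Delta> by (simp add: power4_eq_xxxx)
      then show ?thesis by (simp add: power_divide power_mult_distrib)
    qed
    also have "\<dots> \<le> \<Delta> * (128 * h / \<epsilon> ^ 4)"
      using \<Delta> by (intro mult_left_mono divide_right_mono) auto
    finally show ?thesis by (simp add: \<Delta>_def)
  qed
  have "overshoot \<gamma> \<epsilon> = (\<Union>k\<in>{..<m}. ?E k)" by (auto simp: overshoot_def)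
  also have "prob (\<Union>k\<in>{..<m}. ?E k) \<le> (\<Sum>k\<in>{..<m}. prob (?E k))"
  proof (rule measure_UNION_le)
    show "?E k \<in> events" if "k \<in> {..<m}" for k
    proof -
      from that have [measurable]: "Y \<gamma> k \<in> borel_measurable M" "Y \<gamma> (Suc k) \<in> borel_measurable M"
        using assms(1) by (auto intro!: measurable_Y)
      show "?E k \<in> events" by measurable
    qed
  qed simp
  also have "\<dots> \<le> (\<Sum>k\<in>{..<m}. (t (Suc k) - t k) * (128 * h / \<epsilon> ^ 4))"
    using step by (intro sum_mono) auto
  also have "\<dots> = t m * (128 * h / \<epsilon> ^ 4)"
    unfolding sum_distrib_right[symmetric] by (simp add: sum_lessThan_telescope t_0)
  finally show ?thesis by (simp add: mult_ac)
qed

text \<open>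
  After the passage, the walk with drift goes down by \<open>\<epsilon>\<close> almost as often as it goes up by \<open>\<epsilon>\<close>. The
  drift shifts both normalized thresholds by \<open>\<bar>c\<bar> \<surd>r\<close> with \<open>r \<le> d\<close>, and the tail is Lipschitz.
\<close>

lemma end_symmetry:
  assumes "\<gamma> \<in> \<Gamma>" "k \<le> m" "0 < \<epsilon>" "t m - t k \<le> d"
  shows "prob {\<omega> \<in> space M. S \<gamma> m \<omega> - S \<gamma> k \<omega> \<in> {\<epsilon> + c * (t m - t k)..}} - 2 * \<bar>c\<bar> * sqrt d
    \<le> prob {\<omega> \<in> space M. S \<gamma> m \<omega> - S \<gamma> k \<omega> \<in> {..- \<epsilon> + c * (t m - t k)}}"
proof (cases "k = m")
  case True
  then show ?thesis using assms by simp
next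
  case False
  with assms have "k < m" by simp
  define r where "r = t m - t k"
  have r: "0 < r" "r \<le> d" using t_strict_mono[OF \<open>k < m\<close>] assms by (auto simp: r_def)
  note n = increment_normal[OF assms(1) \<open>k < m\<close> order.refl, folded r_def]
  have "prob {\<omega> \<in> space M. S \<gamma> m \<omega> - S \<gamma> k \<omega> \<ge> \<epsilon> + c * r} = gaussian_tail ((\<epsilon> + c * r) / sqrt r)"
    using n r by (intro normal_upper_tail_closed) auto
  moreover have "prob {\<omega> \<in> space M. S \<gamma> m \<omega> - S \<gamma> k \<omega> \<le> - (\<epsilon> - c * r)} = gaussian_tail ((\<epsilon> - c * r) / sqrt r)"
    using n r by (intro normal_lower_tail_closed) auto
  moreover have "gaussian_tail ((\<epsilon> + c * r) / sqrt r) - gaussian_tail ((\<epsilon> - c * r) / sqrt r) \<le> 2 * \<bar>c\<bar> * sqrt d"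
  proof -
    have eq: "(\<epsilon> - c * r) / sqrt r = (\<epsilon> + c * r) / sqrt r - 2 * c * sqrt r"
      using r by (simp add: field_simps)
    have le: "\<bar>c\<bar> * sqrt r \<le> \<bar>c\<bar> * sqrt d" using r by (intro mult_left_mono) auto
    show ?thesis
    proof (cases "c \<ge> 0")
      case True
      then have "gaussian_tail ((\<epsilon> + c * r) / sqrt r) \<le> gaussian_tail ((\<epsilon> - c * r) / sqrt r)"
        unfolding eq using r by (intro gaussian_tail_antimono) auto
      moreover have "0 \<le> 2 * \<bar>c\<bar> * sqrt d" using r by simp
      ultimately show ?thesis by linarith
    next
      case False
      then have "(\<epsilon> + c * r) / sqrt r \<le> (\<epsilon> - c * r) / sqrt r"
        unfolding eq using r by (simp add: mult_nonpos_nonneg)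
      from gaussian_tail_lipschitz[OF this]
      have "gaussian_tail ((\<epsilon> + c * r) / sqrt r) - gaussian_tail ((\<epsilon> - c * r) / sqrt r) \<le> 2 * (\<bar>c\<bar> * sqrt r)"
        using False by (simp add: eq)
      then show ?thesis using le by linarith
    qed
  qed
  ultimately show ?thesis unfolding r_def[symmetric] by (simp add: algebra_simps)
qed

text \<open>
  A walk ending above \<open>u + 2 \<epsilon>\<close> whose first passage overshoots by at most \<open>\<epsilon>\<close> has gone up by at least
  \<open>\<epsilon>\<close> since then. By symmetry, about as much probability belongs to the walks that passed \<open>u\<close> and then
  went down by \<open>\<epsilon>\<close>, ending below \<open>u\<close>. Together with the walks that end above \<open>u\<close> this gives two tails.
  A walk that is above \<open>u\<close> already at the start of the window has no controlled overshoot. Its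
  probability is the last error term.
\<close>

lemma walk_hit_lower:
  assumes "\<gamma> \<in> \<Gamma>" "k0 \<le> m" "t k0 \<le> s" "0 < s" "\<bar>c\<bar> * t m \<le> u" "t m - t k0 \<le> d" "0 < \<epsilon>"
  shows "gaussian_tail ((u + c * t m) / sqrt (t m)) + gaussian_tail ((u + 2 * \<epsilon> + c * t m) / sqrt (t m))
      - 2 * prob (overshoot \<gamma> \<epsilon>) - 2 * gaussian_tail ((u - \<bar>c\<bar> * t m) / sqrt s)
    \<le> (1 + 2 * \<bar>c\<bar> * sqrt d) * prob (hits \<gamma> u 0 m)"
proof -
  let ?hi = "\<lambda>k. {\<epsilon> + c * (t m - t k)..}" and ?lo = "\<lambda>k. {..- \<epsilon> + c * (t m - t k)}"
  let ?E = "\<lambda>B. {\<omega> \<in> space M. (\<exists>k\<in>{k0..m}. first_passage \<gamma> u k0 k \<omega> \<and> S \<gamma> m \<omega> - S \<gamma> k \<omega> \<in> B k)}"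
  let ?F = "\<lambda>k. prob {\<omega> \<in> space M. first_passage \<gamma> u k0 k \<omega>}"
  let ?O = "overshoot \<gamma> \<epsilon>" and ?K = "{\<omega> \<in> space M. u < Y \<gamma> k0 \<omega>}" and ?L = "hits \<gamma> u k0 m"
  let ?U = "\<lambda>v. {\<omega> \<in> space M. v < Y \<gamma> m \<omega>}"
  have Ym [measurable]: "Y \<gamma> m \<in> borel_measurable M" "Y \<gamma> k0 \<in> borel_measurable M"
    using assms by (auto intro!: measurable_Y)
  have ev: "?O \<in> events" "?K \<in> events" "?U v \<in> events" "?L \<in> events" for v
    using assms by (auto intro!: overshoot_events hits_events)
  have E_ev: "?E B \<in> events" if "\<And>k. B k \<in> sets borel" for B
  proof -
    have [measurable]: "k \<in> {k0..m} \<Longrightarrow> Measurable.pred M (first_passage \<gamma> u k0 k)" 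
       "k \<in> {k0..m} \<Longrightarrow> S \<gamma> k \<in> borel_measurable M" for k
      using assms by (auto intro!: measurable_first_passage measurable_S)
    have [measurable]: "S \<gamma> m \<in> borel_measurable M" using assms by (intro measurable_S) auto
    note that[measurable]
    show ?thesis by measurable
  qed
  have sumE: "prob (?E B) = (\<Sum>k\<in>{k0..m}. ?F k * prob {\<omega> \<in> space M. S \<gamma> m \<omega> - S \<gamma> k \<omega> \<in> B k})"
    if "\<And>k. B k \<in> sets borel" for B
    using first_passage_sum[of \<gamma> k0 m "{}" "\<lambda>_. True" B u] assms that by simp
  have sumL: "prob ?L = (\<Sum>k\<in>{k0..m}. ?F k)"
    using passage_sum[of \<gamma> k0 m "{}" "\<lambda>_. True" u] assms by (simp add: hits_def)
  have small: "Y \<gamma> k \<omega> \<le> u + \<epsilon>"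
    if "first_passage \<gamma> u k0 k \<omega>" "k \<in> {k0..m}" "\<omega> \<in> space M" "\<omega> \<notin> ?O" "\<omega> \<notin> ?K" for k \<omega>
  proof -
    have "k \<noteq> k0" using that by (auto simp: first_passage_def)
    with that(2) obtain j where j: "k = Suc j" "k0 \<le> j" by (cases k) auto
    then have "Y \<gamma> j \<omega> \<le> u" using that(1) by (auto simp: first_passage_def)
    moreover have "\<not> Y \<gamma> (Suc j) \<omega> - Y \<gamma> j \<omega> > \<epsilon>"
    proof -
      have "j < m" using that(2) j by simp
      then show ?thesis using that(3,4) unfolding overshoot_def by blast
    qed
    ultimately show ?thesis using j by simp
  qed
  have "?U (u + 2 * \<epsilon>) \<subseteq> ?E ?hi \<union> (?O \<union> ?K)"
  proof
    fix \<omega> assume U: "\<omega> \<in> ?U (u + 2 * \<epsilon>)"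
    show "\<omega> \<in> ?E ?hi \<union> (?O \<union> ?K)"
    proof (cases "\<omega> \<in> ?O \<union> ?K")
      case False
      have "\<exists>k\<in>{k0..m}. u < Y \<gamma> k \<omega>" using U assms(2,7) by (intro bexI[of _ m]) auto
      then obtain k where k: "k \<in> {k0..m}" "first_passage \<gamma> u k0 k \<omega>" unfolding first_passage_iff by auto
      then have "Y \<gamma> k \<omega> \<le> u + \<epsilon>" using U False by (intro small) auto
      then have "S \<gamma> m \<omega> - S \<gamma> k \<omega> \<in> ?hi k"
        using U by (simp add: Y_def algebra_simps)
      then show ?thesis using k U by auto
    qed simp
  qed
  then have "prob (?U (u + 2 * \<epsilon>)) \<le> prob (?E ?hi \<union> (?O \<union> ?K))"
    using E_ev[of ?hi] ev by (intro finite_measure_mono) auto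
  also have "\<dots> \<le> prob (?E ?hi) + prob (?O \<union> ?K)"
    using E_ev[of ?hi] ev by (intro measure_Un_le) auto
  also have "prob (?O \<union> ?K) \<le> prob ?O + prob ?K"
    using ev by (intro measure_Un_le) auto
  finally have hi: "prob (?U (u + 2 * \<epsilon>)) \<le> prob (?E ?hi) + (prob ?O + prob ?K)" by simp
  have "prob (?E ?hi) - 2 * \<bar>c\<bar> * sqrt d * prob ?L
      = (\<Sum>k\<in>{k0..m}. ?F k * (prob {\<omega> \<in> space M. S \<gamma> m \<omega> - S \<gamma> k \<omega> \<in> ?hi k} - 2 * \<bar>c\<bar> * sqrt d))"
    unfolding sumL by (subst sumE) (auto simp: algebra_simps sum_subtractf sum_distrib_left)
  also have "\<dots> \<le> (\<Sum>k\<in>{k0..m}. ?F k * prob {\<omega> \<in> space M. S \<gamma> m \<omega> - S \<gamma> k \<omega> \<in> ?lo k})"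
  proof (intro sum_mono mult_left_mono)
    fix k assume k: "k \<in> {k0..m}"
    then have "t m - t k \<le> d" using assms(6) t_mono[of k0 k] by auto
    then show "prob {\<omega> \<in> space M. S \<gamma> m \<omega> - S \<gamma> k \<omega> \<in> ?hi k} - 2 * \<bar>c\<bar> * sqrt d
      \<le> prob {\<omega> \<in> space M. S \<gamma> m \<omega> - S \<gamma> k \<omega> \<in> ?lo k}"
      using assms k by (intro end_symmetry) auto
  qed simp
  also have "\<dots> = prob (?E ?lo)" by (rule sumE[symmetric]) auto
  finally have lo: "prob (?E ?hi) - 2 * \<bar>c\<bar> * sqrt d * prob ?L \<le> prob (?E ?lo)" .
  \<comment> \<open>Reaching \<open>u\<close> and then going down by \<open>\<epsilon>\<close> is disjoint from ending above \<open>u\<close>.\<close>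
  have "?U u \<inter> (?E ?lo - (?O \<union> ?K)) = {}"
  proof -
    { fix \<omega> assume \<omega>: "\<omega> \<in> space M" "\<omega> \<notin> ?O" "\<omega> \<notin> ?K" "\<omega> \<in> ?E ?lo"
      then obtain k where k: "k \<in> {k0..m}" "first_passage \<gamma> u k0 k \<omega>" "S \<gamma> m \<omega> - S \<gamma> k \<omega> \<in> ?lo k" by auto
      then have "Y \<gamma> k \<omega> \<le> u + \<epsilon>" using \<omega> by (intro small) auto
      then have "Y \<gamma> m \<omega> \<le> u" using k(3) by (simp add: Y_def algebra_simps) }
    then show ?thesis by fastforce
  qed
  then have "prob (?U u) + prob (?E ?lo - (?O \<union> ?K)) = prob (?U u \<union> (?E ?lo - (?O \<union> ?K)))"
    using ev E_ev[of ?lo] by (intro finite_measure_Union[symmetric]) auto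
  also have "\<dots> \<le> prob ?L"
  proof (rule finite_measure_mono[OF _ ev(4)])
    show "?U u \<union> (?E ?lo - (?O \<union> ?K)) \<subseteq> ?L"
      using assms(2) by (auto simp: hits_def first_passage_def)
  qed
  finally have "prob (?U u) + prob (?E ?lo - (?O \<union> ?K)) \<le> prob ?L" .
  moreover have "prob (?E ?lo) \<le> prob (?E ?lo - (?O \<union> ?K)) + prob (?O \<union> ?K)"
  proof -
    have "prob (?E ?lo) \<le> prob ((?E ?lo - (?O \<union> ?K)) \<union> (?O \<union> ?K))"
      using ev E_ev[of ?lo] by (intro finite_measure_mono) auto
    also have "\<dots> \<le> prob (?E ?lo - (?O \<union> ?K)) + prob (?O \<union> ?K)"
      using ev E_ev[of ?lo] by (intro measure_Un_le) auto
    finally show ?thesis .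
  qed
  moreover note \<open>prob (?O \<union> ?K) \<le> prob ?O + prob ?K\<close>
  ultimately have "prob (?U u) + prob (?U (u + 2 * \<epsilon>)) - 2 * prob ?O - 2 * prob ?K
      \<le> (1 + 2 * \<bar>c\<bar> * sqrt d) * prob ?L"
    using hi lo by (simp add: algebra_simps)
  also have "\<dots> \<le> (1 + 2 * \<bar>c\<bar> * sqrt d) * prob (hits \<gamma> u 0 m)"
  proof (intro mult_left_mono finite_measure_mono hits_events assms(1))
    have "0 \<le> d" using assms(6) t_mono[OF assms(2) order.refl] by simp
    then show "0 \<le> 1 + 2 * \<bar>c\<bar> * sqrt d" by simp
  qed (auto simp: hits_def)
  finally have "prob (?U u) + prob (?U (u + 2 * \<epsilon>)) - 2 * prob ?O - 2 * prob ?K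
      \<le> (1 + 2 * \<bar>c\<bar> * sqrt d) * prob (hits \<gamma> u 0 m)" .
  moreover have "prob ?K \<le> gaussian_tail ((u - \<bar>c\<bar> * t m) / sqrt s)"
    using assms by (intro prob_end_le) auto
  ultimately show ?thesis
    using prob_end_gt[OF assms(1) m_pos order.refl] by (simp add: add.assoc)
qed

section \<open>Several walks reaching a high level\<close>

text \<open>
  The sum on the left is twice the first walk up to \<open>k0\<close> plus the later increments of both walks.
  These are independent, so the variance is \<open>4 t\<^sub>k\<^sub>0 + 2 (t\<^sub>m - t\<^sub>k\<^sub>0) = 2 (t\<^sub>m + t\<^sub>k\<^sub>0)\<close>. The walks may share
  steps in an arbitrary way before \<open>k0\<close>; this is why only one of them enters there.
\<close>

lemma both_ends_le:
  assumes "\<gamma> \<in> \<Gamma>" "\<gamma>' \<in> \<Gamma>" "k0 \<le> m" "a \<gamma>' ` {k0..<m} \<inter> a \<gamma> ` {..<m} = {}"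
    and "t k0 \<le> s" "0 < s" "0 \<le> u + c * t m"
  shows "prob {\<omega> \<in> space M. 2 * (u + c * t m) < S \<gamma> m \<omega> + S \<gamma> k0 \<omega> + (S \<gamma>' m \<omega> - S \<gamma>' k0 \<omega>)}
    \<le> gaussian_tail ((u + c * t m) / sqrt ((t m + s) / 2))"
proof -
  let ?I = "{..<m} <+> {k0..<m}"
  define h where "h = case_sum (a \<gamma>) (a \<gamma>')"
  \<comment> \<open>The steps of the first walk before \<open>k0\<close> have weight 2. The two walks are kept apart by a sum type.\<close>
  define b where "b = (case_sum (\<lambda>i. if i < k0 then 2 else 1) (\<lambda>_. 1) :: nat + nat \<Rightarrow> real)"
  define \<sigma> where "\<sigma> = (\<lambda>i. b i * sqrt (t (Suc (case_sum id id i)) - t (case_sum id id i)))"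
  have b_pos: "0 < b i" for i by (auto simp: b_def split: sum.split)
  have step: "0 < t (Suc k) - t k" if "k < m" for k using t_step that by simp
  have ind: "indep_vars (\<lambda>_. borel) (\<lambda>i \<omega>. b i * \<xi> (h i) \<omega>) ?I"
  proof (rule indep_vars_compose2[where Y="\<lambda>i x. b i * x" and M'="\<lambda>_. borel"])
    have "inj_on h ?I"
    proof (rule inj_onI)
      fix x y assume "x \<in> ?I" "y \<in> ?I" "h x = h y"
      then show "x = y"
        using inj_onD[OF inj[OF assms(1)]] inj_onD[OF inj[OF assms(2)]] assms(4)
        by (auto simp: h_def) (metis IntI atLeastLessThan_iff emptyE imageI lessThan_iff)+
    qed
    then show "indep_vars (\<lambda>_. borel) (\<lambda>i. \<xi> (h i)) ?I"
      using assms index by (intro indep_vars_reindex[OF indep]) (auto simp: h_def)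
  qed simp
  have norm: "distributed M lborel (\<lambda>\<omega>. b i * \<xi> (h i) \<omega>) (normal_density 0 (\<sigma> i))" if "i \<in> ?I" for i
  proof -
    have "distributed M lborel (\<xi> (h i)) (normal_density 0 (sqrt (t (Suc (case_sum id id i)) - t (case_sum id id i))))"
      using that assms normal by (auto simp: h_def)
    from normal_density_affine[OF this, of "b i" 0] show ?thesis
      using that b_pos[of i] step by (auto simp: \<sigma>_def)
  qed
  have "distributed M lborel (\<lambda>\<omega>. \<Sum>i\<in>?I. b i * \<xi> (h i) \<omega>) (normal_density (\<Sum>i\<in>?I. 0) (sqrt (\<Sum>i\<in>?I. (\<sigma> i)\<^sup>2)))"
  proof (rule sum_indep_normal[OF _ _ ind _ norm])
    fix i assume "i \<in> ?I"
    then show "0 < \<sigma> i" using step b_pos[of i] by (auto simp: \<sigma>_def)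
  qed (use m_pos in auto)
  moreover have "(\<Sum>i\<in>?I. b i * \<xi> (h i) \<omega>) = S \<gamma> m \<omega> + S \<gamma> k0 \<omega> + (S \<gamma>' m \<omega> - S \<gamma>' k0 \<omega>)" for \<omega>
  proof -
    have "(\<Sum>i<m. b (Inl i) * \<xi> (h (Inl i)) \<omega>)
        = (\<Sum>i\<in>{..<k0}. b (Inl i) * \<xi> (h (Inl i)) \<omega>) + (\<Sum>i\<in>{k0..<m}. b (Inl i) * \<xi> (h (Inl i)) \<omega>)"
      using assms(3) by (subst sum.union_disjoint[symmetric]) (auto intro!: sum.cong)
    also have "\<dots> = 2 * S \<gamma> k0 \<omega> + (S \<gamma> m \<omega> - S \<gamma> k0 \<omega>)"
      unfolding S_diff[OF assms(3)] by (simp add: S_def b_def h_def sum_distrib_left)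
    finally show ?thesis
      using S_diff[OF assms(3), of \<gamma>' \<omega>] by (simp add: sum.Plus b_def h_def)
  qed
  moreover have "(\<Sum>i\<in>?I. (\<sigma> i)\<^sup>2) = 2 * (t m + t k0)"
  proof -
    have "(\<Sum>i<m. (\<sigma> (Inl i))\<^sup>2) = (\<Sum>i\<in>{0..<k0}. (\<sigma> (Inl i))\<^sup>2) + (\<Sum>i\<in>{k0..<m}. (\<sigma> (Inl i))\<^sup>2)"
      using assms(3) by (subst sum.union_disjoint[symmetric]) (auto intro!: sum.cong)
    also have "(\<Sum>i\<in>{0..<k0}. (\<sigma> (Inl i))\<^sup>2) = 4 * (\<Sum>i\<in>{0..<k0}. (sqrt (t (Suc i) - t i))\<^sup>2)"
      by (auto simp: \<sigma>_def b_def power_mult_distrib sum_distrib_left intro!: sum.cong)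
    also have "(\<Sum>i\<in>{k0..<m}. (\<sigma> (Inl i))\<^sup>2) = (\<Sum>i\<in>{k0..<m}. (sqrt (t (Suc i) - t i))\<^sup>2)"
      by (auto simp: \<sigma>_def b_def intro!: sum.cong)
    finally show ?thesis
      using sum_squares_steps[of 0 k0] sum_squares_steps[of k0 m] assms(3)
      by (simp add: sum.Plus t_0) (simp add: \<sigma>_def b_def)
  qed
  ultimately have "distributed M lborel (\<lambda>\<omega>. S \<gamma> m \<omega> + S \<gamma> k0 \<omega> + (S \<gamma>' m \<omega> - S \<gamma>' k0 \<omega>))
      (normal_density 0 (sqrt (2 * (t m + t k0))))" by simp
  then have "prob {\<omega> \<in> space M. 2 * (u + c * t m) < S \<gamma> m \<omega> + S \<gamma> k0 \<omega> + (S \<gamma>' m \<omega> - S \<gamma>' k0 \<omega>)}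
      = gaussian_tail (2 * (u + c * t m) / sqrt (2 * (t m + t k0)))"
    using horizon_pos t_nonneg[OF assms(3)] by (intro normal_upper_tail) auto
  also have "\<dots> \<le> gaussian_tail ((u + c * t m) / sqrt ((t m + s) / 2))"
  proof (rule gaussian_tail_antimono)
    have "sqrt (2 * (t m + t k0)) = sqrt (2\<^sup>2 * ((t m + t k0) / 2))"
      by (rule arg_cong[where f=sqrt]) (simp add: power2_eq_square)
    also have "\<dots> = 2 * sqrt ((t m + t k0) / 2)"
      by (simp only: real_sqrt_mult) simp
    finally have "2 * (u + c * t m) / sqrt (2 * (t m + t k0)) = (u + c * t m) / sqrt ((t m + t k0) / 2)"
      by (simp only: mult_divide_mult_cancel_left_if) simp
    moreover have "(u + c * t m) / sqrt ((t m + s) / 2) \<le> (u + c * t m) / sqrt ((t m + t k0) / 2)"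
      using assms horizon_pos t_nonneg[OF assms(3)] by (intro divide_left_mono mult_pos_pos) auto
    ultimately show "(u + c * t m) / sqrt ((t m + s) / 2) \<le> 2 * (u + c * t m) / sqrt (2 * (t m + t k0))"
      by simp
  qed
  finally show ?thesis .
qed

text \<open>
  Early passages have negligible probability. If both walks pass late, then \<open>passage_imp_end\<close> applies
  to each of them in turn, the other one providing the event \<open>q\<close>; this costs a factor \<open>\<alpha>\<^sup>-\<^sup>2\<close>. Finally,
  if both end above \<open>u\<close>, then the sum in \<open>both_ends_le\<close> exceeds \<open>2 (u + c t\<^sub>m)\<close> when it is formed with the
  walk that is higher at time \<open>k0\<close>.
\<close>

lemma pair_hit_le:
  assumes "\<gamma> \<in> \<Gamma>" "\<gamma>' \<in> \<Gamma>" "k0 \<le> m"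
    and disj: "a \<gamma>' ` {k0..<m} \<inter> a \<gamma> ` {..<m} = {}" "a \<gamma> ` {k0..<m} \<inter> a \<gamma>' ` {..<m} = {}"
    and "t k0 \<le> s" "0 < s" "\<bar>c\<bar> * t m \<le> u"
  shows "prob (hits \<gamma> u 0 m \<inter> hits \<gamma>' u 0 m)
    \<le> 2 * gaussian_tail ((u - \<bar>c\<bar> * t m) / sqrt s) / gaussian_tail (\<bar>c\<bar> * sqrt (t m))
      + 2 * gaussian_tail ((u + c * t m) / sqrt ((t m + s) / 2)) / (gaussian_tail (\<bar>c\<bar> * sqrt (t m)))\<^sup>2"
proof -
  define \<alpha> where "\<alpha> = gaussian_tail (\<bar>c\<bar> * sqrt (t m))"
  have \<alpha>: "0 < \<alpha>" by (simp add: \<alpha>_def gaussian_tail_pos)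
  have \<alpha>_le: "\<alpha> \<le> gaussian_tail (\<bar>c\<bar> * sqrt (t m - t k0))"
    unfolding \<alpha>_def using t_nonneg[OF assms(3)] by (intro gaussian_tail_antimono mult_left_mono) auto
  have [measurable]: "Y \<gamma> m \<in> borel_measurable M" "Y \<gamma>' m \<in> borel_measurable M"
    "S \<gamma> m \<in> borel_measurable M" "S \<gamma>' m \<in> borel_measurable M"
    "S \<gamma> k0 \<in> borel_measurable M" "S \<gamma>' k0 \<in> borel_measurable M"
    using assms by (auto intro!: measurable_Y measurable_S)
  have ev: "hits g u j l \<in> events" if "g \<in> {\<gamma>, \<gamma>'}" "l \<le> m" for g j l
    using that assms(1,2) by (auto intro!: hits_events)
  define z where "z g k x = (\<Sum>i<k. x (a g i)) - c * t k" for g k and x :: "'i \<Rightarrow> real"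
  have z: "z g k \<in> borel_measurable (PiM (a g ` {..<m}) (\<lambda>_. borel))" if "k \<le> m" for g k
    unfolding z_def using that
    by (intro borel_measurable_diff borel_measurable_sum borel_measurable_const measurable_component_singleton) auto
  have zY: "z g k (\<lambda>i\<in>a g ` {..<m}. \<xi> i \<omega>) = Y g k \<omega>" if "k \<le> m" for g k \<omega>
    using that by (auto simp: z_def Y_def S_def intro!: sum.cong)
  have zY': "(\<exists>k\<in>{j..m}. u < z g k (\<lambda>i\<in>a g ` {..<m}. \<xi> i \<omega>)) \<longleftrightarrow> (\<exists>k\<in>{j..m}. u < Y g k \<omega>)" for g j \<omega>
    by (intro bex_cong refl) (simp add: zY)
  have [measurable]: "k \<in> {k0..m} \<Longrightarrow> z g k \<in> borel_measurable (PiM (a g ` {..<m}) (\<lambda>_. borel))" for g k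
    by (rule z) auto
  have [measurable]: "z g m \<in> borel_measurable (PiM (a g ` {..<m}) (\<lambda>_. borel))" for g
    by (rule z) auto
  have "\<alpha> * prob (hits \<gamma>' u k0 m \<inter> hits \<gamma> u k0 m)
    \<le> prob {\<omega> \<in> space M. (\<exists>k\<in>{k0..m}. u < Y \<gamma>' k \<omega>) \<and> u < Y \<gamma> m \<omega>}"
  proof -
    have "Measurable.pred (PiM (a \<gamma>' ` {..<m}) (\<lambda>_. borel)) (\<lambda>x. \<exists>k\<in>{k0..m}. u < z \<gamma>' k x)"
      by measurable
    from passage_imp_end[OF assms(1) assms(3) order.refl _ _ this \<alpha>_le, of u]
    show ?thesis using disj(2) index[OF assms(2)]
      by (simp only: zY') (auto simp: hits_def Int_def image_subset_iff conj_ac)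
  qed
  also have "\<dots> = prob {\<omega> \<in> space M. u < Y \<gamma> m \<omega> \<and> (\<exists>k\<in>{k0..m}. u < Y \<gamma>' k \<omega>)}"
    by (simp add: conj_commute)
  finally have first: "\<alpha> * prob (hits \<gamma>' u k0 m \<inter> hits \<gamma> u k0 m)
    \<le> prob {\<omega> \<in> space M. u < Y \<gamma> m \<omega> \<and> (\<exists>k\<in>{k0..m}. u < Y \<gamma>' k \<omega>)}" .
  have second: "\<alpha> * prob {\<omega> \<in> space M. u < Y \<gamma> m \<omega> \<and> (\<exists>k\<in>{k0..m}. u < Y \<gamma>' k \<omega>)}
    \<le> prob {\<omega> \<in> space M. u < Y \<gamma> m \<omega> \<and> u < Y \<gamma>' m \<omega>}"
  proof -
    have "Measurable.pred (PiM (a \<gamma> ` {..<m}) (\<lambda>_. borel)) (\<lambda>x. u < z \<gamma> m x)"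
      by measurable
    from passage_imp_end[OF assms(2) assms(3) order.refl _ _ this \<alpha>_le, of u]
    show ?thesis using disj(1) index[OF assms(1)]
      by (simp add: zY image_subset_iff Int_commute)
  qed
  let ?R = "\<lambda>g g'. {\<omega> \<in> space M. 2 * (u + c * t m) < S g m \<omega> + S g k0 \<omega> + (S g' m \<omega> - S g' k0 \<omega>)}"
  let ?e = "gaussian_tail ((u + c * t m) / sqrt ((t m + s) / 2))"
  have v: "0 \<le> u + c * t m"
    using mult_right_mono[OF abs_ge_minus_self[of c], of "t m"] horizon_pos assms(8) by simp
  have "prob {\<omega> \<in> space M. u < Y \<gamma> m \<omega> \<and> u < Y \<gamma>' m \<omega>} \<le> prob (?R \<gamma> \<gamma>' \<union> ?R \<gamma>' \<gamma>)"
  proof (rule finite_measure_mono)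
    show "?R \<gamma> \<gamma>' \<union> ?R \<gamma>' \<gamma> \<in> events" by measurable
    show "{\<omega> \<in> space M. u < Y \<gamma> m \<omega> \<and> u < Y \<gamma>' m \<omega>} \<subseteq> ?R \<gamma> \<gamma>' \<union> ?R \<gamma>' \<gamma>"
    proof safe
      fix \<omega> assume "\<omega> \<in> space M" "u < Y \<gamma> m \<omega>" "u < Y \<gamma>' m \<omega>"
        and "\<not> 2 * (u + c * t m) < S \<gamma>' m \<omega> + S \<gamma>' k0 \<omega> + (S \<gamma> m \<omega> - S \<gamma> k0 \<omega>)"
      then show "2 * (u + c * t m) < S \<gamma> m \<omega> + S \<gamma> k0 \<omega> + (S \<gamma>' m \<omega> - S \<gamma>' k0 \<omega>)"
        by (simp add: Y_def not_less algebra_simps)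
    qed
  qed
  also have "\<dots> \<le> prob (?R \<gamma> \<gamma>') + prob (?R \<gamma>' \<gamma>)"
    by (rule measure_Un_le) measurable
  also have "\<dots> \<le> ?e + ?e"
    using assms v by (intro add_mono both_ends_le) auto
  finally have "\<alpha> * (\<alpha> * prob (hits \<gamma>' u k0 m \<inter> hits \<gamma> u k0 m)) \<le> 2 * ?e"
    using second mult_left_mono[OF first, of \<alpha>] \<alpha> by linarith
  then have "prob (hits \<gamma>' u k0 m \<inter> hits \<gamma> u k0 m) \<le> 2 * ?e / \<alpha>\<^sup>2"
    using \<alpha> by (simp add: pos_le_divide_eq power2_eq_square mult_ac)
  moreover have "prob (hits \<gamma> u 0 k0) \<le> gaussian_tail ((u - \<bar>c\<bar> * t m) / sqrt s) / \<alpha>"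
    "prob (hits \<gamma>' u 0 k0) \<le> gaussian_tail ((u - \<bar>c\<bar> * t m) / sqrt s) / \<alpha>"
    unfolding \<alpha>_def using assms by (auto intro!: early_hit_le)
  moreover have "prob (hits \<gamma> u 0 m \<inter> hits \<gamma>' u 0 m)
      \<le> prob (hits \<gamma>' u k0 m \<inter> hits \<gamma> u k0 m) + (prob (hits \<gamma> u 0 k0) + prob (hits \<gamma>' u 0 k0))"
  proof -
    have "hits \<gamma> u 0 m \<inter> hits \<gamma>' u 0 m
        \<subseteq> (hits \<gamma>' u k0 m \<inter> hits \<gamma> u k0 m) \<union> (hits \<gamma> u 0 k0 \<union> hits \<gamma>' u 0 k0)"
      by (fastforce simp: hits_def)
    then have "prob (hits \<gamma> u 0 m \<inter> hits \<gamma>' u 0 m)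
        \<le> prob ((hits \<gamma>' u k0 m \<inter> hits \<gamma> u k0 m) \<union> (hits \<gamma> u 0 k0 \<union> hits \<gamma>' u 0 k0))"
      using ev assms(3) by (intro finite_measure_mono) auto
    also have "\<dots> \<le> prob (hits \<gamma>' u k0 m \<inter> hits \<gamma> u k0 m) + prob (hits \<gamma> u 0 k0 \<union> hits \<gamma>' u 0 k0)"
      using ev assms(3) by (intro measure_Un_le) auto
    also have "prob (hits \<gamma> u 0 k0 \<union> hits \<gamma>' u 0 k0) \<le> prob (hits \<gamma> u 0 k0) + prob (hits \<gamma>' u 0 k0)"
      using ev assms(3) by (intro measure_Un_le) auto
    finally show ?thesis by simp
  qed
  ultimately show ?thesis unfolding \<alpha>_def[symmetric] by (simp add: add_divide_distrib)
qed

lemma window_exists: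
  assumes "0 < d" "d < t m" "\<And>k. k < m \<Longrightarrow> t (Suc k) - t k \<le> d"
  obtains j where "j \<le> m" "t j \<le> t m - d" "t m - t j \<le> 2 * d"
proof -
  let ?J = "{k. k \<le> m \<and> t k \<le> t m - d}"
  have J: "finite ?J" "?J \<noteq> {}" using assms t_0 by auto
  define j where "j = Max ?J"
  have j: "j \<le> m" "t j \<le> t m - d" using Max_in[OF J] by (auto simp: j_def)
  with assms(1) have "j < m" by (cases "j = m") auto
  have "Suc j \<notin> ?J" using Max_ge[OF J(1), of "Suc j", folded j_def] by auto
  then have "t m - d < t (Suc j)" using \<open>j < m\<close> by auto
  with assms(3)[OF \<open>j < m\<close>] j show ?thesis by (intro that[of j]) auto
qed

lemma union_hits_upper:
  assumes "0 < d" "d < t m" "\<And>k. k < m \<Longrightarrow> t (Suc k) - t k \<le> d" "\<bar>c\<bar> * t m \<le> u"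
  shows "prob (\<Union>\<gamma>\<in>\<Gamma>. hits \<gamma> u 0 m) \<le> real (card \<Gamma>)
    * (gaussian_tail ((u - \<bar>c\<bar> * t m) / sqrt (t m - d)) / gaussian_tail (\<bar>c\<bar> * sqrt (t m))
      + gaussian_tail ((u + c * t m) / sqrt (t m)) / gaussian_tail (\<bar>c\<bar> * sqrt (2 * d)))"
    (is "_ \<le> _ * ?b")
proof -
  obtain j where j: "j \<le> m" "t j \<le> t m - d" "t m - t j \<le> 2 * d"
    by (rule window_exists[OF assms(1-3)])
  have "prob (\<Union>\<gamma>\<in>\<Gamma>. hits \<gamma> u 0 m) \<le> (\<Sum>\<gamma>\<in>\<Gamma>. prob (hits \<gamma> u 0 m))"
    using finite_\<Gamma> by (intro measure_UNION_le hits_events) auto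
  also have "\<dots> \<le> (\<Sum>\<gamma>\<in>\<Gamma>. ?b)"
    using assms j by (intro sum_mono walk_hit_upper) auto
  finally show ?thesis by simp
qed

text \<open>
  The mesh \<open>h\<close> and the overshoot \<open>\<epsilon>\<close> enter only through terms that vanish as \<open>h\<close> and then \<open>\<epsilon>\<close>
  tend to 0. The clause on index sets says that two different walks take disjoint steps from some
  time \<open>t j \<le> s\<close> on.
\<close>

lemma union_hits_lower:
  assumes "0 < d" "d < t m" "\<And>k. k < m \<Longrightarrow> t (Suc k) - t k \<le> h" "\<bar>c\<bar> * t m \<le> u"
    and "h \<le> d" "0 < \<epsilon>" "\<bar>c\<bar> * h \<le> \<epsilon> / 2" "2 * sqrt h \<le> \<epsilon>" "0 < s"
    and sep: "\<And>\<gamma> \<gamma>'. \<gamma> \<in> \<Gamma> \<Longrightarrow> \<gamma>' \<in> \<Gamma> \<Longrightarrow> \<gamma> \<noteq> \<gamma>' \<Longrightarrow>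
      \<exists>j\<le>m. t j \<le> s \<and> a \<gamma> ` {j..<m} \<inter> a \<gamma>' ` {..<m} = {} \<and> a \<gamma>' ` {j..<m} \<inter> a \<gamma> ` {..<m} = {}"
  shows "real (card \<Gamma>) * (2 * gaussian_tail ((u + c * t m) / sqrt (t m)) - 2 * \<epsilon> / sqrt (t m)
      - 256 * t m * h / \<epsilon> ^ 4 - 2 * gaussian_tail ((u - \<bar>c\<bar> * t m) / sqrt (t m - d)))
    \<le> (1 + 2 * \<bar>c\<bar> * sqrt (2 * d)) * (prob (\<Union>\<gamma>\<in>\<Gamma>. hits \<gamma> u 0 m) + (real (card \<Gamma>))\<^sup>2
      * (2 * gaussian_tail ((u - \<bar>c\<bar> * t m) / sqrt s) / gaussian_tail (\<bar>c\<bar> * sqrt (t m))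
      + 2 * gaussian_tail ((u + c * t m) / sqrt ((t m + s) / 2)) / (gaussian_tail (\<bar>c\<bar> * sqrt (t m)))\<^sup>2))"
    (is "_ * ?l \<le> ?C * (_ + _ * ?b)")
proof -
  obtain j where j: "j \<le> m" "t j \<le> t m - d" "t m - t j \<le> 2 * d"
    using window_exists[OF assms(1,2)] assms(3,5) order_trans by metis
  have C: "0 \<le> ?C" using assms(1) by simp
  have "?l \<le> ?C * prob (hits \<gamma> u 0 m)" if \<gamma>: "\<gamma> \<in> \<Gamma>" for \<gamma>
  proof -
    have "gaussian_tail ((u + c * t m) / sqrt (t m)) + gaussian_tail ((u + 2 * \<epsilon> + c * t m) / sqrt (t m))
        - 2 * prob (overshoot \<gamma> \<epsilon>) - 2 * gaussian_tail ((u - \<bar>c\<bar> * t m) / sqrt (t m - d))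
        \<le> ?C * prob (hits \<gamma> u 0 m)"
      using \<gamma> assms j by (intro walk_hit_lower) auto
    moreover have "prob (overshoot \<gamma> \<epsilon>) \<le> 128 * t m * h / \<epsilon> ^ 4"
      using \<gamma> assms by (intro overshoot_le) auto
    moreover have "gaussian_tail ((u + c * t m) / sqrt (t m)) - gaussian_tail ((u + 2 * \<epsilon> + c * t m) / sqrt (t m))
        \<le> (u + 2 * \<epsilon> + c * t m) / sqrt (t m) - (u + c * t m) / sqrt (t m)"
      using assms horizon_pos by (intro gaussian_tail_lipschitz divide_right_mono) auto
    moreover have "(u + 2 * \<epsilon> + c * t m) / sqrt (t m) - (u + c * t m) / sqrt (t m) = 2 * \<epsilon> / sqrt (t m)"
      by (simp add: diff_divide_distrib[symmetric])
    ultimately show ?thesis by linarith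
  qed
  then have "(\<Sum>\<gamma>\<in>\<Gamma>. ?l) \<le> (\<Sum>\<gamma>\<in>\<Gamma>. ?C * prob (hits \<gamma> u 0 m))"
    by (rule sum_mono)
  then have "real (card \<Gamma>) * ?l \<le> ?C * (\<Sum>\<gamma>\<in>\<Gamma>. prob (hits \<gamma> u 0 m))"
    by (simp only: sum_constant sum_distrib_left)
  also have "\<dots> \<le> ?C * (prob (\<Union>\<gamma>\<in>\<Gamma>. hits \<gamma> u 0 m) + (real (card \<Gamma>))\<^sup>2 * ?b)"
  proof (intro mult_left_mono bonferroni_lower finite_\<Gamma> hits_events C order.refl)
    show "0 \<le> ?b" by (intro add_nonneg_nonneg divide_nonneg_nonneg) auto
    fix \<gamma> \<gamma>' assume *: "\<gamma> \<in> \<Gamma>" "\<gamma>' \<in> \<Gamma>" "\<gamma> \<noteq> \<gamma>'"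
    from sep[OF this] obtain i where "i \<le> m" "t i \<le> s"
      "a \<gamma> ` {i..<m} \<inter> a \<gamma>' ` {..<m} = {}" "a \<gamma>' ` {i..<m} \<inter> a \<gamma> ` {..<m} = {}"
      by blast
    with * assms show "prob (hits \<gamma> u 0 m \<inter> hits \<gamma>' u 0 m) \<le> ?b"
      by (intro pair_hit_le[of \<gamma> \<gamma>' i]) auto
  qed
  finally show ?thesis .
qed

end

section \<open>From walks on finer and finer grids to continuous processes\<close>

text \<open>
  The link between processes and walks: at the times of a grid of mesh at most \<open>h\<close>, the processes
  \<open>Z \<gamma>\<close> almost surely agree with walks as above. By the last clause, different processes have
  independent increments after time \<open>s\<close> at the latest. A bound \<open>s < T\<close> that does not depend on the mesh
  keeps their end points away from perfect correlation.
\<close>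

definition walk_grid where
  "walk_grid M Z \<Gamma> T s h A \<xi> a m t \<longleftrightarrow> gaussian_walks M A \<xi> \<Gamma> a m t \<and> t m = T
    \<and> (\<forall>k<m. t (Suc k) - t k \<le> h)
    \<and> (AE \<omega> in M. \<forall>\<gamma>\<in>\<Gamma>. \<forall>k\<le>m. Z \<gamma> (t k) \<omega> = (\<Sum>j<k. \<xi> (a \<gamma> j) \<omega>))
    \<and> (\<forall>\<gamma>\<in>\<Gamma>. \<forall>\<gamma>'\<in>\<Gamma>. \<gamma> \<noteq> \<gamma>' \<longrightarrow>
      (\<exists>j\<le>m. t j \<le> s \<and> a \<gamma> ` {j..<m} \<inter> a \<gamma>' ` {..<m} = {} \<and> a \<gamma>' ` {j..<m} \<inter> a \<gamma> ` {..<m} = {}))"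

text \<open>
  The level is exceeded strictly. Hence, by continuity, a path that exceeds it somewhere does so at
  points of every sufficiently fine grid, and the hitting event is almost surely the limit inferior
  \<open>H\<close> of the events \<open>G n\<close> on the grids. This settles its measurability in the completion and carries
  bounds over from the grids.
\<close>

lemma (in prob_space) hit_set_approx:
  fixes Z :: "'g \<Rightarrow> real \<Rightarrow> 'a \<Rightarrow> real"
  assumes cont: "AE \<omega> in M. \<forall>\<gamma>\<in>\<Gamma>. continuous_on {0..T} (\<lambda>t. Z \<gamma> t \<omega>)"
    and G: "\<And>n. G n \<in> events"
    and K: "\<And>n. K n \<subseteq> {0..T}" "\<And>n x. x \<in> {0..T} \<Longrightarrow> \<exists>y\<in>K n. \<bar>y - x\<bar> \<le> 1 / real (Suc n)"
    and GK: "\<And>n. AE \<omega> in M. \<omega> \<in> G n \<longleftrightarrow> (\<exists>\<gamma>\<in>\<Gamma>. \<exists>y\<in>K n. Z \<gamma> y \<omega> - c * y > u)"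
    and C: "\<And>n. prob (G n) \<le> C"
  defines "E \<equiv> {\<omega> \<in> space M. \<exists>t\<in>{0..T}. \<exists>\<gamma>\<in>\<Gamma>. Z \<gamma> t \<omega> - c * t > u}"
  shows "E \<in> sets (completion M)" "measure (completion M) E \<le> C"
proof -
  define F where "F N = (\<Inter>n\<in>{N..}. G n)" for N :: nat
  define H where "H = (\<Union>N. F N)"
  have F: "F N \<in> events" for N unfolding F_def using G by auto
  then have H: "H \<in> events" unfolding H_def by auto
  have "AE \<omega> in M. \<forall>n. \<omega> \<in> G n \<longleftrightarrow> (\<exists>\<gamma>\<in>\<Gamma>. \<exists>y\<in>K n. Z \<gamma> y \<omega> - c * y > u)"
    using GK by (simp add: AE_all_countable)
  with cont AE_space have HE: "AE \<omega> in M. \<omega> \<in> H \<longleftrightarrow> \<omega> \<in> E"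
  proof eventually_elim
    case (elim \<omega>)
    show ?case
    proof
      assume "\<omega> \<in> H"
      then obtain N where "\<omega> \<in> G N" by (auto simp: H_def F_def)
      then show "\<omega> \<in> E" using elim K(1)[of N] by (auto simp: E_def)
    next
      assume "\<omega> \<in> E"
      then obtain x \<gamma> where x: "x \<in> {0..T}" "\<gamma> \<in> \<Gamma>" "Z \<gamma> x \<omega> - c * x > u" by (auto simp: E_def)
      have "continuous_on {0..T} (\<lambda>t. Z \<gamma> t \<omega> - c * t)"
        using elim x(2) by (intro continuous_intros) auto
      then have "((\<lambda>t. Z \<gamma> t \<omega> - c * t) \<longlongrightarrow> Z \<gamma> x \<omega> - c * x) (at x within {0..T})"
        using x(1) by (auto simp: continuous_on_def)
      then have "\<forall>\<^sub>F y in at x within {0..T}. u < Z \<gamma> y \<omega> - c * y"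
        using x(3) by (rule order_tendstoD)
      then obtain \<delta> where \<delta>: "\<delta> > 0" "\<And>y. y \<in> {0..T} \<Longrightarrow> y \<noteq> x \<Longrightarrow> dist y x < \<delta> \<Longrightarrow> u < Z \<gamma> y \<omega> - c * y"
        by (auto simp: eventually_at)
      obtain N where N: "1 / real (Suc N) < \<delta>" using nat_approx_posE[OF \<delta>(1)] by metis
      have "\<omega> \<in> G n" if "n \<ge> N" for n
      proof -
        obtain y where y: "y \<in> K n" "\<bar>y - x\<bar> \<le> 1 / real (Suc n)" using K(2)[OF x(1)] by blast
        have "1 / real (Suc n) \<le> 1 / real (Suc N)" using that by (intro divide_left_mono) auto
        with y N have "dist y x < \<delta>" by (simp add: dist_real_def)
        then have "u < Z \<gamma> y \<omega> - c * y" using \<delta>(2)[of y] x(3) y(1) K(1)[of n] by (cases "y = x") auto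
        then show ?thesis using elim x(2) y(1) by blast
      qed
      then show "\<omega> \<in> H" by (auto simp: H_def F_def)
    qed
  qed
  then have AEc: "AE \<omega> in completion M. \<omega> \<in> H \<longleftrightarrow> \<omega> \<in> E" by (rule AE_completion)
  show E: "E \<in> sets (completion M)"
    using AEc H by (rule completion.in_sets_AE[OF _ sets_completionI_sets]) (auto simp: E_def)
  have "measure (completion M) E = measure (completion M) H"
    using AEc H E by (intro measure_eq_AE[symmetric]) auto
  also have "\<dots> = prob H" using H by simp
  also have "prob H \<le> C"
  proof (rule LIMSEQ_le_const2)
    show "(\<lambda>N. prob (F N)) \<longlonglongrightarrow> prob H"
      unfolding H_def using F by (intro finite_Lim_measure_incseq) (auto simp: incseq_def F_def)
    show "\<exists>N. \<forall>n\<ge>N. prob (F n) \<le> C"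
    proof (intro exI allI impI)
      fix n
      have "prob (F n) \<le> prob (G n)" using G by (intro finite_measure_mono) (auto simp: F_def)
      also have "\<dots> \<le> C" by (rule C)
      finally show "prob (F n) \<le> C" .
    qed
  qed
  finally show "measure (completion M) E \<le> C" .
qed

text \<open>
  All facts on a single grid that survive the passage to the limit, with the walks themselves hidden.
\<close>

lemma (in prob_space) walk_grid_event:
  fixes Z :: "'g \<Rightarrow> real \<Rightarrow> 'a \<Rightarrow> real" and \<xi> :: "'i \<Rightarrow> 'a \<Rightarrow> real"
  assumes grid: "walk_grid M Z \<Gamma> T s h A \<xi> a m t"
    and "0 < d" "d < T" "h \<le> d" "\<bar>c\<bar> * T \<le> u" "0 < s"
  shows "\<exists>G K. G \<in> events \<and> K \<subseteq> {0..T} \<and> (\<forall>x\<in>{0..T}. \<exists>y\<in>K. \<bar>y - x\<bar> \<le> h)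
    \<and> (AE \<omega> in M. \<omega> \<in> G \<longleftrightarrow> (\<exists>\<gamma>\<in>\<Gamma>. \<exists>y\<in>K. Z \<gamma> y \<omega> - c * y > u))
    \<and> prob G \<le> real (card \<Gamma>)
      * (gaussian_tail ((u - \<bar>c\<bar> * T) / sqrt (T - d)) / gaussian_tail (\<bar>c\<bar> * sqrt T)
        + gaussian_tail ((u + c * T) / sqrt T) / gaussian_tail (\<bar>c\<bar> * sqrt (2 * d)))
    \<and> (\<forall>\<epsilon>. 0 < \<epsilon> \<longrightarrow> \<bar>c\<bar> * h \<le> \<epsilon> / 2 \<longrightarrow> 2 * sqrt h \<le> \<epsilon> \<longrightarrow>
      real (card \<Gamma>) * (2 * gaussian_tail ((u + c * T) / sqrt T) - 2 * \<epsilon> / sqrt T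
        - 256 * T * h / \<epsilon> ^ 4 - 2 * gaussian_tail ((u - \<bar>c\<bar> * T) / sqrt (T - d)))
      \<le> (1 + 2 * \<bar>c\<bar> * sqrt (2 * d)) * (prob G + (real (card \<Gamma>))\<^sup>2
        * (2 * gaussian_tail ((u - \<bar>c\<bar> * T) / sqrt s) / gaussian_tail (\<bar>c\<bar> * sqrt T)
        + 2 * gaussian_tail ((u + c * T) / sqrt ((T + s) / 2)) / (gaussian_tail (\<bar>c\<bar> * sqrt T))\<^sup>2)))"
proof -
  interpret W: gaussian_walks M A \<xi> \<Gamma> a m t c
    using grid by (simp add: walk_grid_def)
  have tm: "t m = T" and mesh: "\<And>k. k < m \<Longrightarrow> t (Suc k) - t k \<le> h"
    and walk: "AE \<omega> in M. \<forall>\<gamma>\<in>\<Gamma>. \<forall>k\<le>m. Z \<gamma> (t k) \<omega> = (\<Sum>j<k. \<xi> (a \<gamma> j) \<omega>)"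
    and sep: "\<And>\<gamma> \<gamma>'. \<gamma> \<in> \<Gamma> \<Longrightarrow> \<gamma>' \<in> \<Gamma> \<Longrightarrow> \<gamma> \<noteq> \<gamma>' \<Longrightarrow>
      \<exists>j\<le>m. t j \<le> s \<and> a \<gamma> ` {j..<m} \<inter> a \<gamma>' ` {..<m} = {} \<and> a \<gamma>' ` {j..<m} \<inter> a \<gamma> ` {..<m} = {}"
    using grid by (auto simp: walk_grid_def)
  have mesh': "\<And>k. k < m \<Longrightarrow> t (Suc k) - t k \<le> d" using mesh assms(4) order_trans by blast
  show ?thesis
  proof (intro exI[of _ "\<Union>\<gamma>\<in>\<Gamma>. W.hits \<gamma> u 0 m"] exI[of _ "t ` {0..m}"] conjI ballI allI impI)
    show "(\<Union>\<gamma>\<in>\<Gamma>. W.hits \<gamma> u 0 m) \<in> events"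
      using W.finite_\<Gamma> by (intro sets.finite_UN W.hits_events) auto
    show "t ` {0..m} \<subseteq> {0..T}"
      using W.t_nonneg W.t_mono tm by auto
    show "\<exists>y\<in>t ` {0..m}. \<bar>y - x\<bar> \<le> h" if x: "x \<in> {0..T}" for x
    proof -
      let ?J = "{k. k \<le> m \<and> t k \<le> x}"
      have J: "finite ?J" "?J \<noteq> {}" using x W.t_0 by auto
      define j where "j = Max ?J"
      have j: "j \<le> m" "t j \<le> x" using Max_in[OF J] by (auto simp: j_def)
      show ?thesis
      proof (cases "j = m")
        case True
        then have "\<bar>t j - x\<bar> \<le> 0" using j x tm by simp
        moreover have "0 \<le> h" using mesh[of 0] W.t_step[of 0] W.m_pos by simp
        ultimately show ?thesis using j by (intro bexI[of _ "t j"]) auto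
      next
        case False
        with j have "j < m" by simp
        have "Suc j \<notin> ?J" using Max_ge[OF J(1), of "Suc j", folded j_def] by auto
        then have "x < t (Suc j)" using \<open>j < m\<close> by auto
        then have "\<bar>t j - x\<bar> \<le> h" using mesh[OF \<open>j < m\<close>] j by auto
        then show ?thesis using j by (intro bexI[of _ "t j"]) auto
      qed
    qed
    show "AE \<omega> in M. \<omega> \<in> (\<Union>\<gamma>\<in>\<Gamma>. W.hits \<gamma> u 0 m) \<longleftrightarrow> (\<exists>\<gamma>\<in>\<Gamma>. \<exists>y\<in>t ` {0..m}. Z \<gamma> y \<omega> - c * y > u)"
      using walk AE_space
    proof eventually_elim
      case (elim \<omega>)
      then show ?case by (auto simp: W.hits_def W.Y_def W.S_def)
    qed
  qed (use W.union_hits_upper[of d u] W.union_hits_lower[of d h u _ s] assms mesh mesh' sep tm in auto)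
qed

text \<open>
  The upper bound follows from a sequence of grids of mesh tending to 0. For the lower bound a single
  grid suffices for each \<open>\<epsilon>\<close>, because passages on a grid are passages of the process; then \<open>\<epsilon>\<close> tends
  to 0. Only \<open>d\<close> remains, which controls the length of the final window.
\<close>

lemma (in prob_space) hit_prob_bounds:
  fixes Z :: "'g \<Rightarrow> real \<Rightarrow> 'a \<Rightarrow> real"
  assumes cont: "AE \<omega> in M. \<forall>\<gamma>\<in>\<Gamma>. continuous_on {0..T} (\<lambda>t. Z \<gamma> t \<omega>)"
    and grids: "\<And>h. 0 < h \<Longrightarrow> \<exists>A (\<xi> :: 'i \<Rightarrow> 'a \<Rightarrow> real) a m t. walk_grid M Z \<Gamma> T s h A \<xi> a m t"
    and "0 < d" "d < T" "\<bar>c\<bar> * T \<le> u" "0 < s"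
  defines "p \<equiv> measure (completion M) {\<omega> \<in> space M. \<exists>t\<in>{0..T}. \<exists>\<gamma>\<in>\<Gamma>. Z \<gamma> t \<omega> - c * t > u}"
  shows "p \<le> real (card \<Gamma>)
      * (gaussian_tail ((u - \<bar>c\<bar> * T) / sqrt (T - d)) / gaussian_tail (\<bar>c\<bar> * sqrt T)
        + gaussian_tail ((u + c * T) / sqrt T) / gaussian_tail (\<bar>c\<bar> * sqrt (2 * d)))"
    and "real (card \<Gamma>) * (2 * gaussian_tail ((u + c * T) / sqrt T)
        - 2 * gaussian_tail ((u - \<bar>c\<bar> * T) / sqrt (T - d)))
      \<le> (1 + 2 * \<bar>c\<bar> * sqrt (2 * d)) * (p + (real (card \<Gamma>))\<^sup>2
        * (2 * gaussian_tail ((u - \<bar>c\<bar> * T) / sqrt s) / gaussian_tail (\<bar>c\<bar> * sqrt T)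
        + 2 * gaussian_tail ((u + c * T) / sqrt ((T + s) / 2)) / (gaussian_tail (\<bar>c\<bar> * sqrt T))\<^sup>2))"
    (is "?n * (2 * ?g - 2 * ?e) \<le> ?C * (p + ?n\<^sup>2 * ?b)")
proof -
  define E where "E = {\<omega> \<in> space M. \<exists>t\<in>{0..T}. \<exists>\<gamma>\<in>\<Gamma>. Z \<gamma> t \<omega> - c * t > u}"
  let ?U = "?n * (?e / gaussian_tail (\<bar>c\<bar> * sqrt T) + ?g / gaussian_tail (\<bar>c\<bar> * sqrt (2 * d)))"
  define Q where "Q h G K \<longleftrightarrow> G \<in> events \<and> K \<subseteq> {0..T} \<and> (\<forall>x\<in>{0..T}. \<exists>y\<in>K. \<bar>y - x\<bar> \<le> h)
      \<and> (AE \<omega> in M. \<omega> \<in> G \<longleftrightarrow> (\<exists>\<gamma>\<in>\<Gamma>. \<exists>y\<in>K. Z \<gamma> y \<omega> - c * y > u)) \<and> prob G \<le> ?U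
      \<and> (\<forall>\<epsilon>. 0 < \<epsilon> \<longrightarrow> \<bar>c\<bar> * h \<le> \<epsilon> / 2 \<longrightarrow> 2 * sqrt h \<le> \<epsilon> \<longrightarrow>
          ?n * (2 * ?g - 2 * \<epsilon> / sqrt T - 256 * T * h / \<epsilon> ^ 4 - 2 * ?e) \<le> ?C * (prob G + ?n\<^sup>2 * ?b))" for h G K
  have Q: "\<exists>G K. Q h G K" if h: "0 < h" "h \<le> d" for h
  proof -
    from grids[OF h(1)] obtain A and \<xi> :: "'i \<Rightarrow> 'a \<Rightarrow> real" and a m t
      where "walk_grid M Z \<Gamma> T s h A \<xi> a m t" by blast
    then show ?thesis
      unfolding Q_def by (rule walk_grid_event[OF _ assms(3,4) h(2) assms(5,6)])
  qed
  define hn where "hn n = min d (1 / real (Suc n))" for n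
  have hn: "0 < hn n" "hn n \<le> d" "hn n \<le> 1 / real (Suc n)" for n
    using assms(3) by (auto simp: hn_def)
  have "\<forall>n. \<exists>G K. Q (hn n) G K" using Q hn by auto
  then obtain Gn Kn where QGK: "\<And>n. Q (hn n) (Gn n) (Kn n)" by metis
  have Gn: "\<And>n. Gn n \<in> events" "\<And>n. Kn n \<subseteq> {0..T}" "\<And>n. prob (Gn n) \<le> ?U"
    "\<And>n. AE \<omega> in M. \<omega> \<in> Gn n \<longleftrightarrow> (\<exists>\<gamma>\<in>\<Gamma>. \<exists>y\<in>Kn n. Z \<gamma> y \<omega> - c * y > u)"
    using QGK unfolding Q_def by auto
  have Kn: "\<exists>y\<in>Kn n. \<bar>y - x\<bar> \<le> 1 / real (Suc n)" if "x \<in> {0..T}" for n x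
  proof -
    have "\<exists>y\<in>Kn n. \<bar>y - x\<bar> \<le> hn n" using QGK[of n] that unfolding Q_def by blast
    then show ?thesis using hn(3)[of n] by (meson order_trans)
  qed
  have E: "E \<in> sets (completion M)" and up: "measure (completion M) E \<le> ?U"
    using hit_set_approx[OF cont Gn(1,2) Kn Gn(4,3), folded E_def] by blast+
  show "p \<le> ?U" using up by (simp only: p_def E_def)
  have low: "?n * (2 * ?g - 2 * ?e) - ?n * (2 / sqrt T + 1) * \<epsilon> \<le> ?C * (p + ?n\<^sup>2 * ?b)"
    if \<epsilon>: "0 < \<epsilon>" for \<epsilon>
  proof -
    have T: "0 < T" using assms(3,4) by simp
    \<comment> \<open>Small enough for the drift, for the tail bound on single steps, and for a total overshoot
    probability of order \<open>\<epsilon>\<close>.\<close>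
    define h where "h = Min {d, \<epsilon> / 2 / (\<bar>c\<bar> + 1), (\<epsilon> / 2)\<^sup>2, \<epsilon> * \<epsilon> ^ 4 / (256 * T)}"
    have pos: "0 < h" using \<epsilon> assms(3) T by (auto simp: h_def)
    have h: "h \<le> d" "h \<le> \<epsilon> / 2 / (\<bar>c\<bar> + 1)" "h \<le> (\<epsilon> / 2)\<^sup>2" "h \<le> \<epsilon> * \<epsilon> ^ 4 / (256 * T)"
      unfolding h_def by (auto simp: min_le_iff_disj)
    have 1: "\<bar>c\<bar> * h \<le> \<epsilon> / 2"
    proof -
      have "\<bar>c\<bar> * h \<le> (\<bar>c\<bar> + 1) * h" using pos by (intro mult_right_mono) auto
      also have "\<dots> \<le> \<epsilon> / 2" using h(2) by (simp add: pos_le_divide_eq algebra_simps)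
      finally show ?thesis .
    qed
    have 2: "2 * sqrt h \<le> \<epsilon>" using real_sqrt_le_mono[OF h(3)] \<epsilon> by simp
    have 3: "256 * T * h / \<epsilon> ^ 4 \<le> \<epsilon>"
      using h(4) \<epsilon> T by (simp add: pos_le_divide_eq pos_divide_le_eq mult_ac)
    obtain G K where GK: "Q h G K" using Q[OF pos h(1)] by blast
    have "AE \<omega> in M. \<omega> \<in> G \<longrightarrow> \<omega> \<in> E"
    proof -
      have "AE \<omega> in M. \<omega> \<in> G \<longleftrightarrow> (\<exists>\<gamma>\<in>\<Gamma>. \<exists>y\<in>K. Z \<gamma> y \<omega> - c * y > u)"
        and K: "K \<subseteq> {0..T}"
        using GK unfolding Q_def by auto
      from this(1) AE_space show ?thesis
        by eventually_elim (use K in \<open>force simp: E_def\<close>)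
    qed
    then have "AE \<omega> in completion M. \<omega> \<in> G \<longrightarrow> \<omega> \<in> E" by (rule AE_completion)
    then have "emeasure (completion M) G \<le> emeasure (completion M) E"
      using E by (rule emeasure_mono_AE)
    moreover have "G \<in> events" using GK by (simp add: Q_def)
    moreover have "emeasure (completion M) E \<noteq> \<infinity>"
    proof -
      have "emeasure (completion M) E \<le> emeasure (completion M) (space M)"
        using E sets.top[of "completion M"] by (intro emeasure_mono) (auto simp: E_def)
      also have "\<dots> = 1" by (simp add: emeasure_space_1)
      finally show ?thesis by (auto simp: top_unique)
    qed
    ultimately have "prob G \<le> p"
      unfolding p_def E_def[symmetric] measure_def by (simp add: enn2real_mono less_top)
    have C: "0 \<le> ?C" using assms(3) by simp
    have "?n * (2 * ?g - 2 * ?e) - ?n * (2 / sqrt T + 1) * \<epsilon> = ?n * (2 * ?g - 2 * \<epsilon> / sqrt T - \<epsilon> - 2 * ?e)"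
      by (simp add: algebra_simps)
    also have "\<dots> \<le> ?n * (2 * ?g - 2 * \<epsilon> / sqrt T - 256 * T * h / \<epsilon> ^ 4 - 2 * ?e)"
      using 3 by (intro mult_left_mono) auto
    also have "\<dots> \<le> ?C * (prob G + ?n\<^sup>2 * ?b)"
      using GK \<epsilon> 1 2 unfolding Q_def by blast
    also have "\<dots> \<le> ?C * (p + ?n\<^sup>2 * ?b)"
      using \<open>prob G \<le> p\<close> C by (intro mult_left_mono) auto
    finally show ?thesis .
  qed
  show "?n * (2 * ?g - 2 * ?e) \<le> ?C * (p + ?n\<^sup>2 * ?b)"
  proof (rule tendsto_upperbound)
    show "((\<lambda>\<epsilon>. ?n * (2 * ?g - 2 * ?e) - ?n * (2 / sqrt T + 1) * \<epsilon>) \<longlongrightarrow> ?n * (2 * ?g - 2 * ?e)) (at_right 0)"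
      by (rule tendsto_eq_intros refl tendsto_ident_at)+ simp
    show "\<forall>\<^sub>F \<epsilon> in at_right 0. ?n * (2 * ?g - 2 * ?e) - ?n * (2 / sqrt T + 1) * \<epsilon> \<le> ?C * (p + ?n\<^sup>2 * ?b)"
      using eventually_at_right_less[of 0] by eventually_elim (rule low)
  qed simp
qed

text \<open>
  Divided by \<open>g u\<close>, the bounds of \<open>hit_prob_bounds\<close> converge to \<open>n / \<Psi> (\<bar>c\<bar> \<surd>(2 d))\<close> and to
  \<open>2 n / (1 + 2 \<bar>c\<bar> \<surd>(2 d))\<close> as \<open>u\<close> tends to infinity, where \<open>n\<close> is the number of processes. Both limits
  tend to \<open>2 n\<close> as \<open>d\<close> tends to 0, because \<open>\<Psi> 0 = 1/2\<close>.
\<close>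

theorem (in prob_space) hit_prob_asymptotics:
  fixes Z :: "'g \<Rightarrow> real \<Rightarrow> 'a \<Rightarrow> real"
  assumes "finite \<Gamma>" "\<Gamma> \<noteq> {}" "0 < s" "s < T"
    and cont: "AE \<omega> in M. \<forall>\<gamma>\<in>\<Gamma>. continuous_on {0..T} (\<lambda>t. Z \<gamma> t \<omega>)"
    and grids: "\<And>h. 0 < h \<Longrightarrow> \<exists>A (\<xi> :: 'i \<Rightarrow> 'a \<Rightarrow> real) a m t. walk_grid M Z \<Gamma> T s h A \<xi> a m t"
  shows "(\<lambda>u. measure (completion M) {\<omega> \<in> space M. \<exists>t\<in>{0..T}. \<exists>\<gamma>\<in>\<Gamma>. Z \<gamma> t \<omega> - c * t > u})
    \<sim>[at_top] (\<lambda>u. real (card \<Gamma>) * (sqrt (2 / pi) * (sqrt T / (u + c * T)) * exp (- ((u + c * T)\<^sup>2 / (2 * T)))))"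
proof -
  have T: "0 < T" using assms by simp
  define p where "p u = measure (completion M) {\<omega> \<in> space M. \<exists>t\<in>{0..T}. \<exists>\<gamma>\<in>\<Gamma>. Z \<gamma> t \<omega> - c * t > u}" for u
  define n where "n = real (card \<Gamma>)"
  have n: "0 < n" using assms by (simp add: n_def card_gt_0_iff)
  define g where "g u = gaussian_tail ((u + c * T) / sqrt T)" for u
  define e where "e \<sigma> u = gaussian_tail ((u - \<bar>c\<bar> * T) / sqrt \<sigma>)" for \<sigma> u
  define f where "f u = gaussian_tail ((u + c * T) / sqrt ((T + s) / 2))" for u
  define \<alpha> where "\<alpha> = gaussian_tail (\<bar>c\<bar> * sqrt T)"
  have g: "0 < g u" for u by (simp add: g_def gaussian_tail_pos)
  have upper: "p u / g u \<le> n * (e (T - d) u / g u / \<alpha> + 1 / gaussian_tail (\<bar>c\<bar> * sqrt (2 * d)))"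
    if "0 < d" "d < T" "\<bar>c\<bar> * T \<le> u" for d u
  proof -
    have "p u \<le> n * (e (T - d) u / \<alpha> + g u / gaussian_tail (\<bar>c\<bar> * sqrt (2 * d)))"
      unfolding p_def n_def e_def g_def \<alpha>_def by (rule hit_prob_bounds(1)[OF cont grids that assms(3)])
    from divide_right_mono[OF this less_imp_le[OF g[of u]]] show ?thesis
      using g[of u] by (simp add: distrib_left add_divide_distrib mult.commute)
  qed
  have lower: "n * (2 - 2 * (e (T - d) u / g u)) / (1 + 2 * \<bar>c\<bar> * sqrt (2 * d))
      - n\<^sup>2 * (2 * (e s u / g u) / \<alpha> + 2 * (f u / g u) / \<alpha>\<^sup>2) \<le> p u / g u"
    if "0 < d" "d < T" "\<bar>c\<bar> * T \<le> u" for d u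
  proof -
    let ?C = "1 + 2 * \<bar>c\<bar> * sqrt (2 * d)"
    have C: "0 < ?C" using that by (simp add: add_pos_nonneg)
    have "n * (2 * g u - 2 * e (T - d) u) \<le> ?C * (p u + n\<^sup>2 * (2 * e s u / \<alpha> + 2 * f u / \<alpha>\<^sup>2))"
      unfolding p_def n_def e_def g_def f_def \<alpha>_def by (rule hit_prob_bounds(2)[OF cont grids that assms(3)])
    then have "n * (2 * g u - 2 * e (T - d) u) / ?C \<le> p u + n\<^sup>2 * (2 * e s u / \<alpha> + 2 * f u / \<alpha>\<^sup>2)"
      using C by (simp add: pos_divide_le_eq mult.commute)
    from divide_right_mono[OF this less_imp_le[OF g[of u]]]
    have "n * (2 * g u - 2 * e (T - d) u) / ?C / g u \<le> p u / g u + n\<^sup>2 * (2 * e s u / \<alpha> + 2 * f u / \<alpha>\<^sup>2) / g u"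
      by (simp add: add_divide_distrib)
    moreover have "n * (2 * g u - 2 * e (T - d) u) / ?C / g u = n * (2 - 2 * (e (T - d) u / g u)) / ?C"
    proof -
      have "(2 * g u - 2 * e (T - d) u) / g u = 2 - 2 * (e (T - d) u / g u)"
        using g[of u] by (simp add: diff_divide_distrib)
      then show ?thesis by (metis divide_divide_eq_left mult.commute times_divide_eq_right)
    qed
    moreover have "n\<^sup>2 * (2 * e s u / \<alpha> + 2 * f u / \<alpha>\<^sup>2) / g u = n\<^sup>2 * (2 * (e s u / g u) / \<alpha> + 2 * (f u / g u) / \<alpha>\<^sup>2)"
      using g[of u] gaussian_tail_pos[of "\<bar>c\<bar> * sqrt T", folded \<alpha>_def] by (simp add: field_simps)
    ultimately show ?thesis by linarith
  qed
  have e0: "((\<lambda>u. e \<sigma> u / g u) \<longlongrightarrow> 0) at_top" if "0 < \<sigma>" "\<sigma> < T" for \<sigma>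
    using gaussian_tail_ratio[of "sqrt \<sigma>" "sqrt T" "- (\<bar>c\<bar> * T)" "c * T"] that T by (simp add: e_def g_def)
  have f0: "((\<lambda>u. f u / g u) \<longlongrightarrow> 0) at_top"
    unfolding f_def g_def using assms by (intro gaussian_tail_ratio) auto
  have right0: "((\<lambda>d. sqrt (2 * d)) \<longlongrightarrow> 0) (at_right 0)"
    by (rule tendsto_eq_intros refl tendsto_ident_at)+ simp
  have "((\<lambda>u. p u / g u) \<longlongrightarrow> 2 * n) at_top"
  proof (rule order_tendstoI)
    fix b assume b: "2 * n < b"
    have "((\<lambda>d. n * (1 / gaussian_tail (\<bar>c\<bar> * sqrt (2 * d)))) \<longlongrightarrow> n * (1 / gaussian_tail (\<bar>c\<bar> * 0))) (at_right 0)"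
      by (intro tendsto_intros isCont_tendsto_compose[OF isCont_gaussian_tail] right0) (simp add: gaussian_tail_0)
    then have "\<forall>\<^sub>F d in at_right 0. n * (1 / gaussian_tail (\<bar>c\<bar> * sqrt (2 * d))) < b"
      using b by (intro order_tendstoD) (auto simp: gaussian_tail_0 mult.commute)
    moreover have "\<forall>\<^sub>F d in at_right 0. 0 < d \<and> d < T"
      using T by (auto simp: eventually_at_right_field)
    ultimately have "\<forall>\<^sub>F d in at_right 0. n * (1 / gaussian_tail (\<bar>c\<bar> * sqrt (2 * d))) < b \<and> (0 < d \<and> d < T)"
      by (rule eventually_conj)
    from eventually_happens'[OF _ this] obtain d where d: "0 < d" "d < T" "n * (1 / gaussian_tail (\<bar>c\<bar> * sqrt (2 * d))) < b"
      by auto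
    have "((\<lambda>u. n * (e (T - d) u / g u / \<alpha> + 1 / gaussian_tail (\<bar>c\<bar> * sqrt (2 * d))))
        \<longlongrightarrow> n * (0 / \<alpha> + 1 / gaussian_tail (\<bar>c\<bar> * sqrt (2 * d)))) at_top"
      using d by (intro tendsto_intros e0) (auto simp: \<alpha>_def gaussian_tail_pos less_imp_neq[symmetric])
    then have "\<forall>\<^sub>F u in at_top. n * (e (T - d) u / g u / \<alpha> + 1 / gaussian_tail (\<bar>c\<bar> * sqrt (2 * d))) < b"
      using d(3) by (intro order_tendstoD) auto
    then show "\<forall>\<^sub>F u in at_top. p u / g u < b"
      using eventually_ge_at_top[of "\<bar>c\<bar> * T"]
    proof eventually_elim
      case (elim u)
      then show ?case using upper[OF d(1,2), of u] by linarith
    qed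
  next
    fix b assume b: "b < 2 * n"
    have "((\<lambda>d. n * (2 - 2 * 0) / (1 + 2 * \<bar>c\<bar> * sqrt (2 * d))) \<longlongrightarrow> n * (2 - 2 * 0) / (1 + 2 * \<bar>c\<bar> * 0)) (at_right 0)"
      by (intro tendsto_intros right0) simp
    then have "\<forall>\<^sub>F d in at_right 0. b < n * (2 - 2 * 0) / (1 + 2 * \<bar>c\<bar> * sqrt (2 * d))"
      using b by (intro order_tendstoD) (auto simp: mult.commute)
    moreover have "\<forall>\<^sub>F d in at_right 0. 0 < d \<and> d < T"
      using T by (auto simp: eventually_at_right_field)
    ultimately have "\<forall>\<^sub>F d in at_right 0. b < n * (2 - 2 * 0) / (1 + 2 * \<bar>c\<bar> * sqrt (2 * d)) \<and> (0 < d \<and> d < T)"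
      by (rule eventually_conj)
    from eventually_happens'[OF _ this] obtain d where d: "0 < d" "d < T" "b < n * (2 - 2 * 0) / (1 + 2 * \<bar>c\<bar> * sqrt (2 * d))"
      by auto
    have C: "1 + 2 * \<bar>c\<bar> * sqrt (2 * d) \<noteq> 0" using d(1) by (simp add: add_pos_nonneg less_imp_neq[symmetric])
    have "((\<lambda>u. n * (2 - 2 * (e (T - d) u / g u)) / (1 + 2 * \<bar>c\<bar> * sqrt (2 * d))
          - n\<^sup>2 * (2 * (e s u / g u) / \<alpha> + 2 * (f u / g u) / \<alpha>\<^sup>2))
        \<longlongrightarrow> n * (2 - 2 * 0) / (1 + 2 * \<bar>c\<bar> * sqrt (2 * d)) - n\<^sup>2 * (2 * 0 / \<alpha> + 2 * 0 / \<alpha>\<^sup>2)) at_top"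
      using d C assms by (intro tendsto_intros e0 f0) (auto simp: \<alpha>_def gaussian_tail_pos less_imp_neq[symmetric])
    then have "\<forall>\<^sub>F u in at_top. b < n * (2 - 2 * (e (T - d) u / g u)) / (1 + 2 * \<bar>c\<bar> * sqrt (2 * d))
          - n\<^sup>2 * (2 * (e s u / g u) / \<alpha> + 2 * (f u / g u) / \<alpha>\<^sup>2)"
      using d(3) by (intro order_tendstoD) auto
    then show "\<forall>\<^sub>F u in at_top. b < p u / g u"
      using eventually_ge_at_top[of "\<bar>c\<bar> * T"]
    proof eventually_elim
      case (elim u)
      then show ?case using lower[OF d(1,2), of u] by linarith
    qed
  qed
  then have "((\<lambda>u. (p u / g u) * (1 / (2 * n))) \<longlongrightarrow> (2 * n) * (1 / (2 * n))) at_top"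
    by (intro tendsto_intros) (use n in auto)
  then have "((\<lambda>u. p u / (n * (2 * g u))) \<longlongrightarrow> 1) at_top"
    using n by (simp add: mult_ac)
  then have "p \<sim>[at_top] (\<lambda>u. n * (2 * g u))" by (rule asymp_equivI')
  also have "(\<lambda>u. n * (2 * g u)) \<sim>[at_top]
      (\<lambda>u. n * (sqrt (2 / pi) * (sqrt T / (u + c * T)) * exp (- ((u + c * T)\<^sup>2 / (2 * T)))))"
    unfolding g_def by (intro asymp_equiv_mult asymp_equiv_refl gaussian_tail_explicit T)
  finally show ?thesis unfolding p_def n_def .
qed

section \<open>Brownian motion\<close>

text \<open>
  A family with one member: the steps are the increments over equal subintervals, and there are no
  pairs to be separated.
\<close>

lemma (in std_brownian_motion) hit_prob_brownian_motion:
  assumes "0 < T"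
  shows "(\<lambda>u. measure (completion M) {\<omega> \<in> space M. \<exists>t\<in>{0..T}. W t \<omega> - c * t > u})
    \<sim>[at_top] (\<lambda>u. sqrt (2 / pi) * (sqrt T / (u + c * T)) * exp (- ((u + c * T)\<^sup>2 / (2 * T))))"
proof -
  have "(\<lambda>u. measure (completion M) {\<omega> \<in> space M. \<exists>t\<in>{0..T}. \<exists>\<gamma>\<in>{()}. W t \<omega> - c * t > u})
    \<sim>[at_top] (\<lambda>u. real (card {()}) * (sqrt (2 / pi) * (sqrt T / (u + c * T)) * exp (- ((u + c * T)\<^sup>2 / (2 * T)))))"
  proof (rule hit_prob_asymptotics[where s="T / 2" and Z="\<lambda>_. W"])
    show "AE \<omega> in M. \<forall>\<gamma>\<in>{()}. continuous_on {0..T} (\<lambda>t. W t \<omega>)"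
      using continuous_paths by eventually_elim (auto intro: continuous_on_subset)
    fix h :: real assume h: "0 < h"
    obtain n0 where n0: "T / h < real n0" using reals_Archimedean2 by blast
    define n where "n = max 1 n0"
    have "T / h < real n" using n0 by (simp add: n_def)
    then have n: "0 < n" "T / real n \<le> h"
      using h assms by (auto simp: n_def field_simps)
    define t where "t k = real k * (T / real n)" for k
    have t_diff: "t (Suc k) - t k = T / real n" for k by (simp add: t_def algebra_simps add_divide_distrib)
    have t_less: "t k < t (Suc k)" for k using t_diff[of k] assms n(1) by (smt (verit) divide_pos_pos of_nat_0_less_iff)
    have t_nonneg: "0 \<le> t k" for k using assms by (simp add: t_def)
    have "walk_grid M (\<lambda>_. W) {()} T (T / 2) h {..<n} (\<lambda>k \<omega>. W (t (Suc k)) \<omega> - W (t k) \<omega>) (\<lambda>_ k. k) n t"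
      unfolding walk_grid_def
    proof (intro conjI allI impI)
      show "gaussian_walks M {..<n} (\<lambda>k \<omega>. W (t (Suc k)) \<omega> - W (t k) \<omega>) {()} (\<lambda>_ k. k) n t"
      proof
        show "indep_vars (\<lambda>_. borel) (\<lambda>k \<omega>. W (t (Suc k)) \<omega> - W (t k) \<omega>) {..<n}"
          using t_less by (intro indep_increments) (auto simp: t_def)
        show "distributed M lborel (\<lambda>\<omega>. W (t (Suc k)) \<omega> - W (t k) \<omega>) (normal_density 0 (sqrt (t (Suc k) - t k)))" for k
          by (intro normal_increments t_nonneg t_less)
      qed (use n t_less in \<open>auto simp: t_def\<close>)
      show "t n = T" using n by (simp add: t_def)
      show "t (Suc k) - t k \<le> h" for k using t_diff n by simp
      show "AE \<omega> in M. \<forall>\<gamma>\<in>{()}. \<forall>k\<le>n. W (t k) \<omega> = (\<Sum>j<k. W (t (Suc j)) \<omega> - W (t j) \<omega>)"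
        using start_zero
      proof eventually_elim
        case (elim \<omega>)
        then show ?case
          using sum_lessThan_telescope[of "\<lambda>k. W (t k) \<omega>"] by (simp add: t_def)
      qed
    qed auto
    then show "\<exists>A (\<xi> :: nat \<Rightarrow> 'a \<Rightarrow> real) a m t. walk_grid M (\<lambda>_. W) {()} T (T / 2) h A \<xi> a m t" by blast
  qed (use assms in auto)
  then show ?thesis by simp
qed

section \<open>Brownian decision trees\<close>

lemma (in std_vector_brownian_motion) indep_increments_coordinates:
  assumes "0 < d"
  shows "indep_vars (\<lambda>_. borel) (\<lambda>(j, l) \<omega>. W j (real (Suc l) * d) \<omega> - W j (real l * d) \<omega>) ({..<n} \<times> {..<k})"
proof -
  have "indep_vars (\<lambda>(j, l). borel) (\<lambda>(j, l) \<omega>. W j (real (Suc l) * d) \<omega> - W j (real l * d) \<omega>) (SIGMA j:{..<n}. {..<k})"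
  proof (rule indep_vars_nested[OF indep_coordinates])
    show "indep_vars (\<lambda>_. borel) (\<lambda>l \<omega>. W j (real (Suc l) * d) \<omega> - W j (real l * d) \<omega>) {..<k}" if "j \<in> {..<n}" for j
    proof -
      interpret W: std_brownian_motion M "W j" using that by (intro coordinates) simp
      show ?thesis using assms by (intro W.indep_increments) auto
    qed
    show "(\<lambda>x. x (real (Suc l) * d) - x (real l * d) :: real) \<in> borel_measurable (\<Pi>\<^sub>M t\<in>{0..}. borel)" for l
      using assms by (intro borel_measurable_diff measurable_component_singleton) auto
  qed (use assms in auto)
  then show ?thesis by (simp add: case_prod_unfold)
qed

text \<open>
  Independence holds on three levels: of the vector motions, of the coordinates of each, and of the
  increments of each coordinate. The step length \<open>d i\<close> depends on the level only.
\<close>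

lemma (in tree_driving_motions) indep_increments_all:
  assumes "\<And>i. i \<le> \<eta> \<Longrightarrow> 0 < d i"
  shows "indep_vars (\<lambda>_. borel) (\<lambda>(i, j, l) \<omega>. X i j (real (Suc l) * d i) \<omega> - X i j (real l * d i) \<omega>)
    (SIGMA i:{..\<eta>}. {..<offspring_prod N i} \<times> {..<k})"
proof -
  have "indep_vars (\<lambda>(i, jl). borel) (\<lambda>(i, jl) \<omega>. X i (fst jl) (real (Suc (snd jl)) * d i) \<omega> - X i (fst jl) (real (snd jl) * d i) \<omega>)
    (SIGMA i:{..\<eta>}. {..<offspring_prod N i} \<times> {..<k})"
  proof (rule indep_vars_nested[OF indep_motions])
    show "indep_vars (\<lambda>_. borel) (\<lambda>jl \<omega>. X i (fst jl) (real (Suc (snd jl)) * d i) \<omega> - X i (fst jl) (real (snd jl) * d i) \<omega>)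
      ({..<offspring_prod N i} \<times> {..<k})" if "i \<in> {..\<eta>}" for i
    proof -
      interpret V: std_vector_brownian_motion M "offspring_prod N i" "X i" using that by (intro vector_motions) simp
      show ?thesis
        using V.indep_increments_coordinates[of "d i" k] assms that by (simp add: case_prod_unfold)
    qed
    show "(\<lambda>x. x (fst jl, real (Suc (snd jl)) * d i) - x (fst jl, real (snd jl) * d i) :: real)
        \<in> borel_measurable (\<Pi>\<^sub>M p\<in>{..<offspring_prod N i} \<times> {0..}. borel)"
      if "i \<in> {..\<eta>}" "jl \<in> {..<offspring_prod N i} \<times> {..<k}" for i jl
      using assms[of i] that by (intro borel_measurable_diff measurable_component_singleton) auto
  qed (use assms in \<open>auto simp: less_imp_le\<close>)
  then show ?thesis by (simp add: case_prod_unfold)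
qed

locale brownian_decision_tree = tree_driving_motions M \<eta> N X
  for M :: "'a measure" and \<eta> :: nat and N :: "nat \<Rightarrow> nat" and X :: "nat \<Rightarrow> nat \<Rightarrow> real \<Rightarrow> 'a \<Rightarrow> real" +
  fixes \<tau> :: "nat \<Rightarrow> real" and T :: real
  assumes \<eta>_pos: "1 \<le> \<eta>" and \<tau>_pos: "0 < \<tau> 1"
    and \<tau>_less: "1 \<le> i \<Longrightarrow> i < \<eta> \<Longrightarrow> \<tau> i < \<tau> (Suc i)"
    and \<tau>_less_T: "\<tau> \<eta> < T"
    and N_pos: "1 \<le> i \<Longrightarrow> i \<le> \<eta> \<Longrightarrow> 1 \<le> N i"
begin

abbreviation P :: "nat \<Rightarrow> nat" where
  "P \<equiv> offspring_prod N"

lemma P_0: "P 0 = 1"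
  by (simp add: offspring_prod_def)

lemma P_Suc: "P (Suc i) = P i * N (Suc i)"
  by (simp add: offspring_prod_def)

lemma P_pos: "i \<le> \<eta> \<Longrightarrow> 0 < P i"
  by (induction i) (use N_pos in \<open>force simp: P_0 P_Suc\<close>)+

lemma mod_P_mod_P: "\<gamma> mod P (Suc i) mod P i = \<gamma> mod P i"
  by (rule mod_mod_cancel) (simp add: P_Suc)

text \<open>
  The branching times with the conventions \<open>\<tau>\<^sub>0 = 0\<close> and \<open>\<tau>\<^sub>\<eta>\<^sub>+\<^sub>1 = T\<close>, which \<open>\<tau>\<close> itself need not
  satisfy.
\<close>

definition brk :: "nat \<Rightarrow> real" where
  "brk i = (if i = 0 then 0 else if i \<le> \<eta> then \<tau> i else T)"

lemma brk_less: "i \<le> \<eta> \<Longrightarrow> brk i < brk (Suc i)"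
  using \<tau>_pos \<tau>_less[of i] \<tau>_less_T \<eta>_pos by (cases "i = \<eta>") (auto simp: brk_def Suc_le_eq)

lemma brk_mono: "i \<le> j \<Longrightarrow> j \<le> Suc \<eta> \<Longrightarrow> brk i \<le> brk j"
proof (induction j rule: dec_induct)
  case (step j)
  then show ?case using brk_less[of j] by simp
qed simp

lemma brk_0: "brk 0 = 0" and brk_end: "brk (Suc \<eta>) = T" and brk_Suc: "i < \<eta> \<Longrightarrow> brk (Suc i) = \<tau> (Suc i)"
  by (simp_all add: brk_def)

lemma T_pos: "0 < T"
  using brk_mono[of 1 "Suc \<eta>"] brk_less[of 0] by (simp add: brk_0 brk_end)

lemma tree_level_eq:
  assumes "i \<le> \<eta>" "brk i < t" "t \<le> brk (Suc i)"
  shows "tree_level \<eta> \<tau> t = i"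
proof (cases "i = 0")
  case True
  then show ?thesis using assms \<eta>_pos by (simp add: tree_level_def brk_def)
next
  case False
  have brk_\<tau>: "brk k = \<tau> k" if "1 \<le> k" "k \<le> \<eta>" for k using that by (simp add: brk_def)
  have "\<tau> 1 < t"
    using brk_mono[of 1 i] assms False \<eta>_pos by (simp add: brk_\<tau>[symmetric])
  moreover have "Max {k \<in> {1..\<eta>}. t > \<tau> k} = i"
  proof (rule Max_eqI)
    show "i \<in> {k \<in> {1..\<eta>}. t > \<tau> k}" using assms False brk_\<tau>[of i] by auto
    fix k assume k: "k \<in> {k \<in> {1..\<eta>}. t > \<tau> k}"
    show "k \<le> i"
    proof (rule ccontr)
      assume "\<not> k \<le> i"
      then have "brk (Suc i) \<le> brk k" using k by (intro brk_mono) auto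
      then show False using k assms(3) brk_\<tau>[of k] by auto
    qed
  qed simp
  ultimately show ?thesis by (simp add: tree_level_def)
qed

text \<open>
  The position that branch \<open>\<gamma>\<close> inherits at the beginning of the \<open>i\<close>-th interval. It is 0 on the first
  interval, where the branch is the driving motion itself.
\<close>

definition inherited :: "nat \<Rightarrow> nat \<Rightarrow> 'a \<Rightarrow> real" where
  "inherited \<gamma> i \<omega> = (case i of 0 \<Rightarrow> 0 | Suc k \<Rightarrow> level_vector \<tau> N X k (\<tau> i) \<omega> (\<gamma> mod P k))"

lemma level_vector_eq:
  "i \<le> \<eta> \<Longrightarrow> level_vector \<tau> N X i t \<omega> (\<gamma> mod P i) = inherited \<gamma> i \<omega> + X i (\<gamma> mod P i) (t - brk i) \<omega>"
  by (cases i) (simp_all add: inherited_def brk_def mod_P_mod_P)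

definition starts_at_0 :: "'a \<Rightarrow> bool" where
  "starts_at_0 \<omega> \<longleftrightarrow> (\<forall>i\<le>\<eta>. \<forall>j<P i. X i j 0 \<omega> = 0)"

lemma AE_starts_at_0: "AE \<omega> in M. starts_at_0 \<omega>"
proof -
  have "AE \<omega> in M. X i j 0 \<omega> = 0" if "i \<le> \<eta>" "j < P i" for i j
    using std_vector_brownian_motion.coordinates[OF vector_motions[OF that(1)] that(2)]
    by (rule std_brownian_motion.start_zero)
  then have "AE \<omega> in M. \<forall>i\<in>{..\<eta>}. \<forall>j\<in>{..<P i}. X i j 0 \<omega> = 0"
    by (intro AE_finite_allI) auto
  then show ?thesis by eventually_elim (auto simp: starts_at_0_def)
qed

text \<open>
  The branch is defined by the formula of level \<open>i\<close> on an interval open to the left. At the left end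
  point the level is \<open>i - 1\<close>, and the two formulas agree because the motion of level \<open>i\<close> starts at 0.
\<close>

lemma branch_eq:
  assumes "starts_at_0 \<omega>" "i \<le> \<eta>" "brk i \<le> t" "t \<le> brk (Suc i)"
  shows "branch \<eta> \<tau> N X \<gamma> t \<omega> = inherited \<gamma> i \<omega> + X i (\<gamma> mod P i) (t - brk i) \<omega>"
proof (cases "t = brk i")
  case False
  then have "tree_level \<eta> \<tau> t = i" using assms by (intro tree_level_eq) auto
  then show ?thesis using assms by (simp add: branch_def level_vector_eq)
next
  case True
  have X0: "X i (\<gamma> mod P i) 0 \<omega> = 0"
    using assms(1,2) P_pos[of i] by (simp add: starts_at_0_def)
  show ?thesis
  proof (cases i)
    case 0
    then have "tree_level \<eta> \<tau> t = 0" using True \<tau>_pos by (simp add: tree_level_def brk_0)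
    then show ?thesis using True 0 by (simp add: branch_def inherited_def brk_0)
  next
    case (Suc k)
    then have "tree_level \<eta> \<tau> t = k"
      using True assms brk_less[of k] by (intro tree_level_eq) auto
    then show ?thesis using True Suc X0 assms(2) by (simp add: branch_def inherited_def brk_def)
  qed
qed

lemma continuous_branch:
  "AE \<omega> in M. \<forall>\<gamma>\<in>{0..<P \<eta>}. continuous_on {0..T} (\<lambda>t. branch \<eta> \<tau> N X \<gamma> t \<omega>)"
proof -
  have "AE \<omega> in M. continuous_on {0..} (\<lambda>t. X i j t \<omega>)" if "i \<le> \<eta>" "j < P i" for i j
    using std_vector_brownian_motion.coordinates[OF vector_motions[OF that(1)] that(2)]
    by (rule std_brownian_motion.continuous_paths)
  then have "AE \<omega> in M. \<forall>i\<in>{..\<eta>}. \<forall>j\<in>{..<P i}. continuous_on {0..} (\<lambda>t. X i j t \<omega>)"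
    by (intro AE_finite_allI) auto
  with AE_starts_at_0 show ?thesis
  proof eventually_elim
    case (elim \<omega>)
    show ?case
    proof
      fix \<gamma> assume "\<gamma> \<in> {0..<P \<eta>}"
      have piece: "continuous_on {brk i..brk (Suc i)} (\<lambda>t. branch \<eta> \<tau> N X \<gamma> t \<omega>)" if i: "i \<le> \<eta>" for i
      proof -
        have "continuous_on {0..} (\<lambda>t. X i (\<gamma> mod P i) t \<omega>)" using elim(2) i P_pos[OF i] by auto
        then have "continuous_on {brk i..brk (Suc i)} (\<lambda>t. X i (\<gamma> mod P i) (t - brk i) \<omega>)"
          by (rule continuous_on_compose2) (auto intro!: continuous_intros)
        then have "continuous_on {brk i..brk (Suc i)} (\<lambda>t. inherited \<gamma> i \<omega> + X i (\<gamma> mod P i) (t - brk i) \<omega>)"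
          by (intro continuous_intros)
        then show ?thesis
          by (rule continuous_on_eq) (use branch_eq[OF elim(1) i] in auto)
      qed
      have "continuous_on {0..brk (Suc i)} (\<lambda>t. branch \<eta> \<tau> N X \<gamma> t \<omega>)" if "i \<le> \<eta>" for i
        using that
      proof (induction i)
        case 0
        then show ?case using piece[of 0] by (simp add: brk_0)
      next
        case (Suc i)
        have "{0..brk (Suc (Suc i))} = {0..brk (Suc i)} \<union> {brk (Suc i)..brk (Suc (Suc i))}"
          using brk_mono[of 0 "Suc i"] brk_less[of "Suc i"] Suc.prems by (auto simp: brk_0)
        then show ?case using Suc piece[of "Suc i"] by (auto intro!: continuous_on_closed_Un)
      qed
      from this[of \<eta>] show "continuous_on {0..T} (\<lambda>t. branch \<eta> \<tau> N X \<gamma> t \<omega>)"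
        by (simp add: brk_end)
    qed
  qed
qed

text \<open>
  Each of the \<open>\<eta> + 1\<close> intervals between consecutive branching times is divided into \<open>n\<close> equal parts.
  Grid point number \<open>k = i n + l\<close> with \<open>l < n\<close> is point \<open>l\<close> of interval \<open>i\<close>, so \<open>i\<close> and \<open>l\<close> are
  quotient and remainder of \<open>k\<close> by \<open>n\<close>.
\<close>

definition stepsize :: "nat \<Rightarrow> nat \<Rightarrow> real" where
  "stepsize n i = (brk (Suc i) - brk i) / real n"

definition grid_time :: "nat \<Rightarrow> nat \<Rightarrow> real" where
  "grid_time n k = brk (k div n) + real (k mod n) * stepsize n (k div n)"

definition grid_increment :: "nat \<Rightarrow> nat \<times> nat \<times> nat \<Rightarrow> 'a \<Rightarrow> real" where
  "grid_increment n = (\<lambda>(i, j, l) \<omega>. X i j (real (Suc l) * stepsize n i) \<omega> - X i j (real l * stepsize n i) \<omega>)"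

definition grid_index :: "nat \<Rightarrow> nat \<Rightarrow> nat \<Rightarrow> nat \<times> nat \<times> nat" where
  "grid_index n \<gamma> k = (k div n, \<gamma> mod P (k div n), k mod n)"

lemma stepsize_pos: "0 < n \<Longrightarrow> i \<le> \<eta> \<Longrightarrow> 0 < stepsize n i"
  using brk_less[of i] by (simp add: stepsize_def)

text \<open>
  The end point \<open>l = n\<close> of an interval is also the first point of the next one.
\<close>

lemma grid_time_eq:
  assumes "0 < n" "l \<le> n"
  shows "grid_time n (i * n + l) = brk i + real l * stepsize n i"
proof (cases "l = n")
  case True
  then have "i * n + l = Suc i * n" by simp
  then have "grid_time n (i * n + l) = brk (Suc i)"
    using assms(1) by (simp only: grid_time_def) (simp del: mult_Suc)
  then show ?thesis using True assms by (simp add: stepsize_def)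
next
  case False
  then show ?thesis using assms by (simp add: grid_time_def)
qed

lemma grid_time_step:
  assumes "0 < n"
  shows "grid_time n (Suc k) - grid_time n k = stepsize n (k div n)"
proof -
  have "k mod n < n" using assms by simp
  then have "grid_time n (k div n * n + Suc (k mod n)) - grid_time n (k div n * n + k mod n) = stepsize n (k div n)"
    using assms by (simp only: grid_time_eq) (simp add: algebra_simps)
  then show ?thesis by (simp del: mult_Suc mult_Suc_right)
qed

lemma div_le_levels: "0 < n \<Longrightarrow> k < Suc \<eta> * n \<Longrightarrow> k div n \<le> \<eta>"
  using less_mult_imp_div_less[of k "Suc \<eta>" n] by simp

text \<open>
  Inside one level the increments telescope. At a change of level the branch continues from the
  position inherited from its parent, as \<open>(\<gamma> mod P (Suc i)) mod P i = \<gamma> mod P i\<close>.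
\<close>

lemma sum_grid_increments:
  assumes "starts_at_0 \<omega>" "0 < n" "i \<le> \<eta>" "l \<le> n"
  shows "(\<Sum>k<i * n + l. grid_increment n (grid_index n \<gamma> k) \<omega>)
    = inherited \<gamma> i \<omega> + X i (\<gamma> mod P i) (real l * stepsize n i) \<omega>"
  using assms(3,4)
proof (induction i arbitrary: l)
  have block: "(\<Sum>k<i * n + l. grid_increment n (grid_index n \<gamma> k) \<omega>)
      = (\<Sum>k<i * n. grid_increment n (grid_index n \<gamma> k) \<omega>) + X i (\<gamma> mod P i) (real l * stepsize n i) \<omega>"
    if "i \<le> \<eta>" "l \<le> n" for i l
    using that(2)
  proof (induction l)
    case 0
    then show ?case using assms(1) that(1) P_pos[of i] by (simp add: starts_at_0_def)
  next
    case (Suc l)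
    then show ?case by (simp add: grid_increment_def grid_index_def)
  qed
  {
    case 0
    then show ?case using block[of 0 l] by (simp add: inherited_def)
  next
    case (Suc i)
    have "(\<Sum>k<Suc i * n. grid_increment n (grid_index n \<gamma> k) \<omega>)
        = (\<Sum>k<i * n + n. grid_increment n (grid_index n \<gamma> k) \<omega>)" by (simp add: add.commute)
    also have "\<dots> = inherited \<gamma> i \<omega> + X i (\<gamma> mod P i) (real n * stepsize n i) \<omega>"
      using Suc by simp
    also have "real n * stepsize n i = \<tau> (Suc i) - brk i"
      using assms(2) Suc.prems by (simp add: stepsize_def brk_Suc)
    also have "inherited \<gamma> i \<omega> + X i (\<gamma> mod P i) (\<tau> (Suc i) - brk i) \<omega> = inherited \<gamma> (Suc i) \<omega>"
      using Suc.prems by (simp add: level_vector_eq[symmetric]) (simp add: inherited_def)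
    finally show ?case using block[of "Suc i" l] Suc.prems by simp
  }
qed

lemma branch_grid_time:
  assumes "starts_at_0 \<omega>" "0 < n" "k \<le> Suc \<eta> * n"
  shows "branch \<eta> \<tau> N X \<gamma> (grid_time n k) \<omega> = (\<Sum>j<k. grid_increment n (grid_index n \<gamma> j) \<omega>)"
proof -
  obtain i l where il: "k = i * n + l" "i \<le> \<eta>" "l \<le> n"
  proof (cases "k = Suc \<eta> * n")
    case True
    then show ?thesis by (intro that[of \<eta> n]) auto
  next
    case False
    then have "k div n \<le> \<eta>" using assms by (intro div_le_levels) auto
    then show ?thesis using assms(2) by (intro that[of "k div n" "k mod n"]) auto
  qed
  have s: "0 < stepsize n i" using assms(2) il(2) by (rule stepsize_pos)
  have "real l * stepsize n i \<le> real n * stepsize n i" using il(3) s by (intro mult_right_mono) auto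
  also have "\<dots> = brk (Suc i) - brk i" using assms(2) by (simp add: stepsize_def)
  finally have "brk i \<le> grid_time n k" "grid_time n k \<le> brk (Suc i)"
    using il s assms(2) by (auto simp: grid_time_eq)
  then have "branch \<eta> \<tau> N X \<gamma> (grid_time n k) \<omega> = inherited \<gamma> i \<omega> + X i (\<gamma> mod P i) (grid_time n k - brk i) \<omega>"
    using assms(1) il(2) by (intro branch_eq)
  also have "grid_time n k - brk i = real l * stepsize n i"
    using il assms(2) by (simp add: grid_time_eq)
  finally show ?thesis using sum_grid_increments[OF assms(1,2) il(2,3)] il(1) by simp
qed

lemma gaussian_walks_tree:
  assumes n: "0 < n"
  shows "gaussian_walks M (SIGMA i:{..\<eta>}. {..<P i} \<times> {..<n}) (grid_increment n) {0..<P \<eta>} (grid_index n)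
    (Suc \<eta> * n) (grid_time n)"
proof
  show "0 < Suc \<eta> * n" using n by simp
  show "grid_time n 0 = 0" by (simp add: grid_time_def brk_0)
  show "grid_time n k < grid_time n (Suc k)" if "k < Suc \<eta> * n" for k
    using grid_time_step[OF n, of k] stepsize_pos[OF n div_le_levels[OF n that]] by simp
  show "indep_vars (\<lambda>_. borel) (grid_increment n) (SIGMA i:{..\<eta>}. {..<P i} \<times> {..<n})"
    unfolding grid_increment_def using n stepsize_pos by (intro indep_increments_all) auto
  fix \<gamma>
  show "inj_on (grid_index n \<gamma>) {..<Suc \<eta> * n}"
    by (rule inj_onI) (metis (no_types, lifting) div_mult_mod_eq grid_index_def prod.inject)
  fix k assume k: "k < Suc \<eta> * n"
  have i: "k div n \<le> \<eta>" using n k by (rule div_le_levels)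
  show "grid_index n \<gamma> k \<in> (SIGMA i:{..\<eta>}. {..<P i} \<times> {..<n})"
    using i n P_pos[OF i] by (simp add: grid_index_def)
  interpret W: std_brownian_motion M "X (k div n) (\<gamma> mod P (k div n))"
    using i P_pos[OF i] by (intro std_vector_brownian_motion.coordinates[OF vector_motions]) auto
  have s: "0 < stepsize n (k div n)" using n i by (rule stepsize_pos)
  have "distributed M lborel (grid_increment n (grid_index n \<gamma> k))
    (normal_density 0 (sqrt (real (Suc (k mod n)) * stepsize n (k div n) - real (k mod n) * stepsize n (k div n))))"
    unfolding grid_increment_def grid_index_def prod.case
    using s by (intro W.normal_increments) auto
  also have "real (Suc (k mod n)) * stepsize n (k div n) - real (k mod n) * stepsize n (k div n)
      = grid_time n (Suc k) - grid_time n k"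
    by (simp add: grid_time_step[OF n] algebra_simps)
  finally show "distributed M lborel (grid_increment n (grid_index n \<gamma> k))
    (normal_density 0 (sqrt (grid_time n (Suc k) - grid_time n k)))" .
qed simp

text \<open>
  Different branches may share steps up to the last branching time. After it, branch \<open>\<gamma>\<close> takes the
  steps of coordinate \<open>\<gamma> mod P \<eta> = \<gamma>\<close> of the last motion, and these are its own.
\<close>

lemma walk_grid_tree:
  assumes "0 < n" "T / real n \<le> h"
  shows "walk_grid M (branch \<eta> \<tau> N X) {0..<P \<eta>} T (\<tau> \<eta>) h
    (SIGMA i:{..\<eta>}. {..<P i} \<times> {..<n}) (grid_increment n) (grid_index n) (Suc \<eta> * n) (grid_time n)"
  unfolding walk_grid_def
proof (intro conjI allI impI ballI gaussian_walks_tree assms(1))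
  show "grid_time n (Suc \<eta> * n) = T"
    using assms(1) by (simp only: grid_time_def) (simp add: brk_end del: mult_Suc)
  show "grid_time n (Suc k) - grid_time n k \<le> h" if "k < Suc \<eta> * n" for k
  proof -
    have "brk (Suc (k div n)) - brk (k div n) \<le> T"
      using div_le_levels[OF assms(1) that] brk_mono[of 0 "k div n"] brk_mono[of "Suc (k div n)" "Suc \<eta>"]
      by (simp add: brk_0 brk_end)
    then have "stepsize n (k div n) \<le> T / real n" unfolding stepsize_def by (intro divide_right_mono) auto
    then show ?thesis using assms by (simp add: grid_time_step)
  qed
  show "AE \<omega> in M. \<forall>\<gamma>\<in>{0..<P \<eta>}. \<forall>k\<le>Suc \<eta> * n.
      branch \<eta> \<tau> N X \<gamma> (grid_time n k) \<omega> = (\<Sum>j<k. grid_increment n (grid_index n \<gamma> j) \<omega>)"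
    using AE_starts_at_0
  proof eventually_elim
    case (elim \<omega>)
    then show ?case using branch_grid_time[OF elim assms(1)] by blast
  qed
  have last_level: "grid_index n \<gamma> ` {\<eta> * n..<Suc \<eta> * n} \<inter> grid_index n \<gamma>' ` {..<Suc \<eta> * n} = {}"
    if "\<gamma> < P \<eta>" "\<gamma>' < P \<eta>" "\<gamma> \<noteq> \<gamma>'" for \<gamma> \<gamma>'
  proof -
    have "grid_index n \<gamma> k \<noteq> grid_index n \<gamma>' k'" if "k \<in> {\<eta> * n..<Suc \<eta> * n}" for k k'
    proof
      assume eq: "grid_index n \<gamma> k = grid_index n \<gamma>' k'"
      have "\<eta> \<le> k div n" using that assms(1) by (simp add: less_eq_div_iff_mult_less_eq)
      moreover have "k div n \<le> \<eta>" using that assms(1) by (intro div_le_levels) auto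
      ultimately have "k div n = \<eta>" by simp
      then have "\<gamma> mod P \<eta> = \<gamma>' mod P \<eta>" using eq by (auto simp: grid_index_def)
      then show False using \<open>\<gamma> < P \<eta>\<close> \<open>\<gamma>' < P \<eta>\<close> \<open>\<gamma> \<noteq> \<gamma>'\<close> by simp
    qed
    then show ?thesis by blast
  qed
  fix \<gamma> \<gamma>' assume "\<gamma> \<in> {0..<P \<eta>}" "\<gamma>' \<in> {0..<P \<eta>}" "\<gamma> \<noteq> \<gamma>'"
  moreover have "grid_time n (\<eta> * n) \<le> \<tau> \<eta>"
    using grid_time_eq[OF assms(1), of 0 \<eta>] \<eta>_pos by (simp add: brk_def)
  ultimately show "\<exists>j\<le>Suc \<eta> * n. grid_time n j \<le> \<tau> \<eta>
      \<and> grid_index n \<gamma> ` {j..<Suc \<eta> * n} \<inter> grid_index n \<gamma>' ` {..<Suc \<eta> * n} = {}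
      \<and> grid_index n \<gamma>' ` {j..<Suc \<eta> * n} \<inter> grid_index n \<gamma> ` {..<Suc \<eta> * n} = {}"
    using last_level[of \<gamma> \<gamma>'] last_level[of \<gamma>' \<gamma>] by (intro exI[of _ "\<eta> * n"]) auto
qed

lemma hit_prob_tree:
  "(\<lambda>u. measure (completion M) {\<omega> \<in> space M. \<exists>t\<in>{0..T}. \<exists>\<gamma>\<in>{0..<P \<eta>}. branch \<eta> \<tau> N X \<gamma> t \<omega> - c * t > u})
    \<sim>[at_top] (\<lambda>u. real (P \<eta>) * (sqrt (2 / pi) * (sqrt T / (u + c * T)) * exp (- ((u + c * T)\<^sup>2 / (2 * T)))))"
proof -
  have "(\<lambda>u. measure (completion M) {\<omega> \<in> space M. \<exists>t\<in>{0..T}. \<exists>\<gamma>\<in>{0..<P \<eta>}. branch \<eta> \<tau> N X \<gamma> t \<omega> - c * t > u})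
    \<sim>[at_top] (\<lambda>u. real (card {0..<P \<eta>}) * (sqrt (2 / pi) * (sqrt T / (u + c * T)) * exp (- ((u + c * T)\<^sup>2 / (2 * T)))))"
  proof (rule hit_prob_asymptotics[OF _ _ _ _ continuous_branch])
    show "0 < \<tau> \<eta>" using brk_mono[of 1 \<eta>] brk_less[of 0] \<eta>_pos by (simp add: brk_def)
    show "{0..<P \<eta>} \<noteq> {}" using P_pos[of \<eta>] by simp
    fix h :: real assume h: "0 < h"
    obtain n0 where n0: "T / h < real n0" using reals_Archimedean2 by blast
    have "0 < T / h" using T_pos h by simp
    with n0 have "0 < n0" by (cases n0) auto
    moreover have "T / real n0 \<le> h" using n0 h \<open>0 < n0\<close> by (simp add: field_simps)
    ultimately show "\<exists>A (\<xi> :: nat \<times> nat \<times> nat \<Rightarrow> 'a \<Rightarrow> real) a m t.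
        walk_grid M (branch \<eta> \<tau> N X) {0..<P \<eta>} T (\<tau> \<eta>) h A \<xi> a m t"
      using walk_grid_tree by blast
  qed (use \<tau>_less_T in auto)
  then show ?thesis by simp
qed

end

section \<open>Both probabilities have the same explicit asymptotics\<close>

theorem theorem3p1:
  fixes M :: "'a measure" and M' :: "'b measure"
    and T c :: real and \<eta> :: nat and \<tau> :: "nat \<Rightarrow> real" and N :: "nat \<Rightarrow> nat"
    and X :: "nat \<Rightarrow> nat \<Rightarrow> real \<Rightarrow> 'a \<Rightarrow> real" and B :: "real \<Rightarrow> 'b \<Rightarrow> real"
  assumes "T > 0" and "\<eta> \<ge> 1"
    and "0 < \<tau> 1" and "\<And>i. 1 \<le> i \<Longrightarrow> i < \<eta> \<Longrightarrow> \<tau> i < \<tau> (Suc i)" and "\<tau> \<eta> < T"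
    and "\<And>i. 1 \<le> i \<Longrightarrow> i \<le> \<eta> \<Longrightarrow> N i \<ge> 1"
    and "tree_driving_motions M \<eta> N X"
    and "std_brownian_motion M' B"
  shows "(\<lambda>u. measure (completion M)
              {\<omega> \<in> space M. \<exists>t\<in>{0..T}. \<exists>\<gamma>\<in>{0..<offspring_prod N \<eta>}.
                 branch \<eta> \<tau> N X \<gamma> t \<omega> - c * t > u})
           \<sim>[at_top]
         (\<lambda>u. real (offspring_prod N \<eta>) *
              measure (completion M') {\<omega> \<in> space M'. \<exists>t\<in>{0..T}. B t \<omega> - c * t > u})
       \<and> (\<lambda>u. real (offspring_prod N \<eta>) *
              measure (completion M') {\<omega> \<in> space M'. \<exists>t\<in>{0..T}. B t \<omega> - c * t > u})
           \<sim>[at_top]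
         (\<lambda>u. real (offspring_prod N \<eta>) * sqrt (2 / pi) * (sqrt T / (u + c * T)) *
              exp (- ((u + c * T)\<^sup>2 / (2 * T))))"
proof -
  interpret tree: brownian_decision_tree M \<eta> N X \<tau> T
    using assms by (intro brownian_decision_tree.intro brownian_decision_tree_axioms.intro) auto
  interpret B: std_brownian_motion M' B by (rule assms(8))
  have single: "(\<lambda>u. real (offspring_prod N \<eta>) *
        measure (completion M') {\<omega> \<in> space M'. \<exists>t\<in>{0..T}. B t \<omega> - c * t > u})
      \<sim>[at_top] (\<lambda>u. real (offspring_prod N \<eta>) *
        (sqrt (2 / pi) * (sqrt T / (u + c * T)) * exp (- ((u + c * T)\<^sup>2 / (2 * T)))))"
    by (intro asymp_equiv_mult asymp_equiv_refl B.hit_prob_brownian_motion assms(1))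
  then show ?thesis
    using asymp_equiv_trans[OF tree.hit_prob_tree asymp_equiv_symI[OF single]] by (simp add: mult.assoc)
qed

end
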